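(* The Mathieu group $M_{23}$ is generated by symbols $\mathfrak{s},\mathfrak{j},\mathfrak{t},\mathfrak{r},\mathfrak{u},\mathfrak{v}$, subject to the defining relations $$\mathfrak{s}^2=\mathfrak{j}^2=\mathfrak{t}^2=\mathfrak{r}^3=(\mathfrak{j}\mathfrak{r})^2=(\mathfrak{t}\mathfrak{r})^2=(\mathfrak{s}\mathfrak{r})^3=(\mathfrak{j}\mathfrak{s})^3=(\mathfrak{t}\mathfrak{j})^3=(\mathfrak{t}\mathfrak{s}\mathfrak{t}\mathfrak{j}\mathfrak{s})^3=1,$$ $$\mathfrak{t}\mathfrak{s}\mathfrak{t}\cdot\mathfrak{j}\mathfrak{r}\cdot\mathfrak{t}\mathfrak{s}\mathfrak{t}=\mathfrak{r}\mathfrak{s}\mathfrak{r}^{-1}\mathfrak{j}\mathfrak{r}\cdot\mathfrak{t}\mathfrak{s}\mathfrak{t}\cdot\mathfrak{r}\mathfrak{s}\mathfrak{r}^{-1}\mathfrak{j}\mathfrak{r}^{-1}\mathfrak{s}\mathfrak{r}^{-1},$$ $$\mathfrak{u}^2=(\mathfrak{u}\mathfrak{s})^2=(\mathfrak{u}\mathfrak{j})^3=1,\quad \mathfrak{r}^{\mathfrak{u}}=\mathfrak{r}^{\mathfrak{j}},\quad \mathfrak{s}^{\mathfrak{t}\mathfrak{u}}=\mathfrak{s}\,\mathfrak{s}^{\mathfrak{t}},\quad \mathfrak{s}^{\mathfrak{j}\mathfrak{t}\mathfrak{u}}=\mathfrak{s}^{\mathfrak{j}\mathfrak{t}}\,\mathfrak{s}^{\mathfrak{t}\mathfrak{j}\mathfrak{t}},$$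 $$\mathfrak{v}^2=(\mathfrak{v}\mathfrak{s})^2=(\mathfrak{v}\mathfrak{u})^3=(\mathfrak{v}\mathfrak{j})^2=(\mathfrak{v}\mathfrak{r})^2=1,\quad \mathfrak{s}^{\mathfrak{t}\mathfrak{v}}=\mathfrak{s}^{\mathfrak{t}\mathfrak{r}},\quad \mathfrak{s}^{\mathfrak{j}\mathfrak{t}\mathfrak{v}}=\mathfrak{s}^{\mathfrak{j}\mathfrak{t}\mathfrak{r}}.$$
   Context: Conventions: $x^y=y^{-1}xy$; permutations are composed from right to left. The statement means that the abstract group with this presentation is isomorphic to $M_{23}$, with the symbols corresponding to the following permutations. Let $\zeta$ be a primitive element of $GF(4)$ and $\Omega=\mathbb{P}^2(4)$ the set of 21 points $[x,y,z]$ of the projective plane over $GF(4)$, on which matrices act by left multiplication on column vectors $(x,y,z)^t$. Let $u,v\notin\Omega$ be two distinct new points and $\Omega''=\Omega\cup\{u,v\}$. The symbols $\mathfrak{s},\mathfrak{j},\mathfrak{t},\mathfrak{r}$ correspond to the elements of $PSL_3(4)$ (acting on $\Omega$, fixing $u,v$) induced by the matrices $\begin{pmatrix}1&1&0\\0&1&0\\0&0&1\end{pmatrix}$, $\begin{pmatrix}0&1&0\\1&0&0\\0&0&1\end{pmatrix}$, $\begin{pmatrix}0&0&1\\0&1&0\\1&0&0\end{pmatrix}$, $\begin{pmatrix}\zeta&0&0\\0&1&0\\0&0&\zeta^{-1}\end{pmatrix}$, respectively; $\mathfrak{u}$ corresponds to the permutation fixing $v$ with $u\mapsto[1,0,0]$,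 $[1,0,0]\mapsto u$, and $[x,y,z]\mapsto[x^2+yz,y^2,z^2]$ for $[x,y,z]\in\Omega\setminus\{[1,0,0]\}$; $\mathfrak{v}$ corresponds to the permutation interchanging $u$ and $v$ with $[x,y,z]\mapsto[x^2,y^2,\zeta z^2]$ on $\Omega$. $M_{23}$ is the ($4$-transitive) permutation group on $\Omega''$ generated by $PSL_3(4)$, $\mathfrak{u}$ and $\mathfrak{v}$. *)

theory Defs
  imports
    "HOL-Algebra.Bij"
    "HOL-Algebra.Generated_Groups"
    "HOL-Analysis.Determinants"
begin

section \<open>Group presentations\<close>

text \<open>A word is a list of letters; \<open>(a, True)\<close> stands for the generator \<open>a\<close> and
  \<open>(a, False)\<close> for its formal inverse.\<close>

inductive cancel :: "('a \<times> bool) list \<Rightarrow> ('a \<times> bool) list \<Rightarrow> bool" where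
  "cancel (xs @ (a, b) # (a, \<not> b) # ys) (xs @ ys)"

quotient_type 'a free_elem = "('a \<times> bool) list" / "equivclp cancel"
  by simp

lemma equivclp_map:
  assumes "\<And>x y. r x y \<Longrightarrow> equivclp r (f x) (f y)" "equivclp r x y"
  shows "equivclp r (f x) (f y)"
  using assms(2)
proof (induction rule: equivclp_induct)
  case base
  then show ?case by simp
next
  case (step y z)
  then have "equivclp r (f y) (f z)"
    using assms(1) by (blast intro: equivclp_sym)
  with step.IH show ?case by (rule equivclp_trans)
qed

lemma cancel_append:
  assumes "cancel x y"
  shows "cancel (zs @ x @ zs') (zs @ y @ zs')"
  using assms
proof cases
  case (1 xs a b ys)
  then show ?thesis using cancel.intros[of "zs @ xs" a b "ys @ zs'"] by simp
qed

lift_definition free_mult :: "'a free_elem \<Rightarrow> 'a free_elem \<Rightarrow> 'a free_elem" is "(@)"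
proof -
  fix x x' y y' :: "('a \<times> bool) list"
  assume x: "equivclp cancel x x'" and y: "equivclp cancel y y'"
  have "equivclp cancel (x @ y) (x' @ y)"
    using x by (rule equivclp_map[rotated]) (use cancel_append[of _ _ "[]"] in auto)
  moreover have "equivclp cancel (x' @ y) (x' @ y')"
    using y by (rule equivclp_map[rotated]) (use cancel_append[of _ _ _ "[]"] in auto)
  ultimately show "equivclp cancel (x @ y) (x' @ y')" by (rule equivclp_trans)
qed

lift_definition free_one :: "'a free_elem" is "[]" .

lift_definition free_gen :: "'a \<Rightarrow> 'a free_elem" is "\<lambda>a. [(a, True)]" .

definition free_group :: "'a free_elem monoid" where
  "free_group = \<lparr>carrier = UNIV, monoid.mult = free_mult, one = free_one\<rparr>"

lemma cancel_inverse_word: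
  "equivclp cancel (map (\<lambda>(a, b). (a, \<not> b)) (rev w) @ w) []"
proof (induction w)
  case Nil
  then show ?case by simp
next
  case (Cons l w)
  obtain a b where l: "l = (a, b)" by (cases l)
  have "cancel (map (\<lambda>(a, b). (a, \<not> b)) (rev w) @ (a, \<not> b) # (a, \<not> \<not> b) # w)
          (map (\<lambda>(a, b). (a, \<not> b)) (rev w) @ w)"
    by (rule cancel.intros)
  with Cons show ?case by (auto simp: l intro: equivclp_trans)
qed

lemma free_mult_assoc: "free_mult (free_mult x y) z = free_mult x (free_mult y z)"
  by transfer (metis append_assoc equivclp_refl)

lemma free_mult_one_left: "free_mult free_one x = x"
  by transfer (metis append_Nil equivclp_refl)

lemma free_mult_inverse_left: "\<exists>y. free_mult y x = free_one"
  by transfer (blast intro: cancel_inverse_word)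

lemma group_free_group: "group free_group"
  by (rule groupI)
    (simp_all add: free_group_def free_mult_assoc free_mult_one_left free_mult_inverse_left)

definition normal_closure :: "('a, 'b) monoid_scheme \<Rightarrow> 'a set \<Rightarrow> 'a set" where
  "normal_closure G S = \<Inter> {N. N \<lhd> G \<and> S \<subseteq> N}"

text \<open>A relation \<open>l = r\<close> is represented by the pair \<open>(l, r)\<close> of elements of the free group.\<close>

definition relators :: "('a free_elem \<times> 'a free_elem) set \<Rightarrow> 'a free_elem set" where
  "relators R = {l \<otimes>\<^bsub>free_group\<^esub> inv\<^bsub>free_group\<^esub> r | l r. (l, r) \<in> R}"

definition presented_group ::
    "('a free_elem \<times> 'a free_elem) set \<Rightarrow> 'a free_elem set monoid" where
  "presented_group R = free_group Mod normal_closure free_group (relators R)"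

definition presented_gen ::
    "('a free_elem \<times> 'a free_elem) set \<Rightarrow> 'a \<Rightarrow> 'a free_elem set" where
  "presented_gen R a =
     normal_closure free_group (relators R) #>\<^bsub>free_group\<^esub> free_gen a"


section \<open>The presentation\<close>

definition conj_by :: "('a, 'b) monoid_scheme \<Rightarrow> 'a \<Rightarrow> 'a \<Rightarrow> 'a"
    (infixl \<open>\<triangleleft>\<index>\<close> 72) where
  "x \<triangleleft>\<^bsub>G\<^esub> y = inv\<^bsub>G\<^esub> y \<otimes>\<^bsub>G\<^esub> x \<otimes>\<^bsub>G\<^esub> y"

context
  fixes G :: "('a, 'b) monoid_scheme" (structure)
begin

definition M23_relations_in ::
    "'a \<Rightarrow> 'a \<Rightarrow> 'a \<Rightarrow> 'a \<Rightarrow> 'a \<Rightarrow> 'a \<Rightarrow> ('a \<times> 'a) set" where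
  "M23_relations_in s j t r u v =
    {(s [^] (2::nat), \<one>), (j [^] (2::nat), \<one>), (t [^] (2::nat), \<one>), (r [^] (3::nat), \<one>),
     ((j \<otimes> r) [^] (2::nat), \<one>), ((t \<otimes> r) [^] (2::nat), \<one>), ((s \<otimes> r) [^] (3::nat), \<one>),
     ((j \<otimes> s) [^] (3::nat), \<one>), ((t \<otimes> j) [^] (3::nat), \<one>),
     ((t \<otimes> s \<otimes> t \<otimes> j \<otimes> s) [^] (3::nat), \<one>),
     ((t \<otimes> s \<otimes> t) \<otimes> (j \<otimes> r) \<otimes> (t \<otimes> s \<otimes> t),
      (r \<otimes> s \<otimes> inv r \<otimes> j \<otimes> r) \<otimes> (t \<otimes> s \<otimes> t) \<otimes>
      (r \<otimes> s \<otimes> inv r \<otimes> j \<otimes> inv r \<otimes> s \<otimes> inv r)),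
     (u [^] (2::nat), \<one>), ((u \<otimes> s) [^] (2::nat), \<one>), ((u \<otimes> j) [^] (3::nat), \<one>),
     (r \<triangleleft> u, r \<triangleleft> j),
     (s \<triangleleft> (t \<otimes> u), s \<otimes> (s \<triangleleft> t)),
     (s \<triangleleft> (j \<otimes> t \<otimes> u), (s \<triangleleft> (j \<otimes> t)) \<otimes> (s \<triangleleft> (t \<otimes> j \<otimes> t))),
     (v [^] (2::nat), \<one>), ((v \<otimes> s) [^] (2::nat), \<one>), ((v \<otimes> u) [^] (3::nat), \<one>),
     ((v \<otimes> j) [^] (2::nat), \<one>), ((v \<otimes> r) [^] (2::nat), \<one>),
     (s \<triangleleft> (t \<otimes> v), s \<triangleleft> (t \<otimes> r)),
     (s \<triangleleft> (j \<otimes> t \<otimes> v), s \<triangleleft> (j \<otimes> t \<otimes> r))}"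

end

datatype M23_symbol = sym_s | sym_j | sym_t | sym_r | sym_u | sym_v

definition M23_relations :: "(M23_symbol free_elem \<times> M23_symbol free_elem) set" where
  "M23_relations = M23_relations_in free_group (free_gen sym_s) (free_gen sym_j)
     (free_gen sym_t) (free_gen sym_r) (free_gen sym_u) (free_gen sym_v)"


section \<open>The permutation group\<close>

definition primitive_element :: "'k::field \<Rightarrow> bool" where
  "primitive_element z \<longleftrightarrow> range (\<lambda>n::nat. z ^ n) = {x. x \<noteq> 0}"

definition proportional :: "'k::field ^ 3 \<Rightarrow> 'k ^ 3 \<Rightarrow> bool" where
  "proportional v w \<longleftrightarrow> v \<noteq> 0 \<and> (\<exists>c. c \<noteq> 0 \<and> w = c *s v)"

lemma part_equivp_proportional: "part_equivp (proportional :: 'k::field ^ 3 \<Rightarrow> _)"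
proof (rule part_equivpI)
  have "proportional (1 :: 'k ^ 3) 1"
    by (auto simp: proportional_def vec_eq_iff intro!: exI[of _ 1])
  then show "\<exists>v :: 'k ^ 3. proportional v v" by blast
  show "symp (proportional :: 'k ^ 3 \<Rightarrow> _)"
  proof (rule sympI)
    fix v w :: "'k ^ 3"
    assume "proportional v w"
    then obtain c where c: "v \<noteq> 0" "c \<noteq> 0" "w = c *s v" by (auto simp: proportional_def)
    have "inverse c *s w = v" using c by (simp add: vec_eq_iff)
    with c show "proportional w v"
      unfolding proportional_def by (metis inverse_nonzero_iff_nonzero vector_mul_eq_0)
  qed
  show "transp (proportional :: 'k ^ 3 \<Rightarrow> _)"
  proof (rule transpI)
    fix x y z :: "'k ^ 3"
    assume "proportional x y" "proportional y z"
    then obtain c d where "x \<noteq> 0" "c \<noteq> 0" "d \<noteq> 0" "y = c *s x" "z = d *s y"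
      by (auto simp: proportional_def)
    then show "proportional x z"
      unfolding proportional_def by (metis mult_eq_0_iff vector_smult_assoc)
  qed
qed

quotient_type (overloaded) 'k proj_plane = "'k::field ^ 3" / partial: proportional
  by (rule part_equivp_proportional)

text \<open>The point \<open>[x, y, z]\<close>; meaningful only if the coordinates are not all zero.\<close>

definition pt :: "'k::field \<Rightarrow> 'k \<Rightarrow> 'k \<Rightarrow> 'k proj_plane" where
  "pt x y z = abs_proj_plane (vector [x, y, z])"

lemma proportional_refl_iff: "proportional v v \<longleftrightarrow> v \<noteq> 0"
  by (auto simp: proportional_def intro!: exI[of _ 1])

lemma vector_3_eq_0_iff: "(vector [x, y, z] :: 'k::field ^ 3) = 0 \<longleftrightarrow> x = 0 \<and> y = 0 \<and> z = 0"
  by (simp add: vec_eq_iff forall_3)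

lemma proportional_vector_3:
  "proportional (vector [x, y, z] :: 'k::field ^ 3) w \<longleftrightarrow>
     \<not> (x = 0 \<and> y = 0 \<and> z = 0) \<and> (\<exists>c. c \<noteq> 0 \<and> w $ 1 = c * x \<and> w $ 2 = c * y \<and> w $ 3 = c * z)"
  by (auto simp: proportional_def vector_3_eq_0_iff vec_eq_iff forall_3)

lemma pt_eq_iff:
  assumes "\<not> (x = 0 \<and> y = 0 \<and> z = 0)" "\<not> (x' = 0 \<and> y' = 0 \<and> z' = 0)"
  shows "pt x y z = pt x' y' z' \<longleftrightarrow> (\<exists>c. c \<noteq> 0 \<and> x' = c * x \<and> y' = c * y \<and> z' = c * z)"
  using Quotient3_rel[OF Quotient3_proj_plane, of "vector [x, y, z]" "vector [x', y', z']"] assms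
  by (simp add: pt_def proportional_refl_iff vector_3_eq_0_iff proportional_vector_3)

text \<open>The side conditions \<open>invertible A\<close> and \<open>z \<noteq> 0\<close> only serve to make the following maps
  total; the maps are never used outside of them.\<close>

lift_definition mat_act :: "'k::field ^ 3 ^ 3 \<Rightarrow> 'k proj_plane \<Rightarrow> 'k proj_plane"
  is "\<lambda>A w. if invertible A then A *v w else w"
proof -
  fix A :: "'k ^ 3 ^ 3" and v w :: "'k ^ 3"
  assume vw: "proportional v w"
  then obtain c where c: "v \<noteq> 0" "c \<noteq> 0" "w = c *s v" by (auto simp: proportional_def)
  have "A *v v \<noteq> 0" if A: "invertible A"
  proof
    assume "A *v v = 0"
    moreover obtain B where "B ** A = mat 1" using A by (auto simp: invertible_def)
    ultimately have "v = B *v 0" by (metis matrix_vector_mul_assoc matrix_vector_mul_lid)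
    with c(1) show False by simp
  qed
  moreover have "A *v w = c *s (A *v v)" by (simp only: c(3) vector_scalar_commute)
  ultimately show "proportional (if invertible A then A *v v else v) (if invertible A then A *v w else w)"
    using vw c(2) by (cases "invertible A") (auto simp: proportional_def)
qed

lift_definition u_map :: "'k::field proj_plane \<Rightarrow> 'k proj_plane"
  is "\<lambda>w. vector [(w $ 1)\<^sup>2 + w $ 2 * w $ 3, (w $ 2)\<^sup>2, (w $ 3)\<^sup>2]"
proof -
  fix v w :: "'k ^ 3"
  assume "proportional v w"
  then obtain c where "v \<noteq> 0" "c \<noteq> 0" "w = c *s v" by (auto simp: proportional_def)
  then show "proportional (vector [(v $ 1)\<^sup>2 + v $ 2 * v $ 3, (v $ 2)\<^sup>2, (v $ 3)\<^sup>2])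
      (vector [(w $ 1)\<^sup>2 + w $ 2 * w $ 3, (w $ 2)\<^sup>2, (w $ 3)\<^sup>2])"
    by (auto simp: proportional_vector_3 vec_eq_iff forall_3 power2_eq_square algebra_simps
        intro!: exI[of _ "c * c"])
qed

lift_definition v_map :: "'k::field \<Rightarrow> 'k proj_plane \<Rightarrow> 'k proj_plane"
  is "\<lambda>z w. if z \<noteq> 0 then vector [(w $ 1)\<^sup>2, (w $ 2)\<^sup>2, z * (w $ 3)\<^sup>2] else w"
proof -
  fix z :: 'k and v w :: "'k ^ 3"
  assume vw: "proportional v w"
  then obtain c where "v \<noteq> 0" "c \<noteq> 0" "w = c *s v" by (auto simp: proportional_def)
  then have "proportional (vector [(v $ 1)\<^sup>2, (v $ 2)\<^sup>2, z * (v $ 3)\<^sup>2])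
      (vector [(w $ 1)\<^sup>2, (w $ 2)\<^sup>2, z * (w $ 3)\<^sup>2])" if "z \<noteq> 0"
    using that by (auto simp: proportional_vector_3 vec_eq_iff forall_3 power2_eq_square
        intro!: exI[of _ "c * c"])
  with vw show "proportional (if z \<noteq> 0 then vector [(v $ 1)\<^sup>2, (v $ 2)\<^sup>2, z * (v $ 3)\<^sup>2] else v)
      (if z \<noteq> 0 then vector [(w $ 1)\<^sup>2, (w $ 2)\<^sup>2, z * (w $ 3)\<^sup>2] else w)"
    by simp
qed

lemma u_map_pt:
  assumes "\<not> (x = 0 \<and> y = 0 \<and> z = 0)"
  shows "u_map (pt x y z) = pt (x\<^sup>2 + y * z) (y\<^sup>2) (z\<^sup>2)"
  using assms by (simp add: pt_def u_map.abs_eq proportional_refl_iff vector_3_eq_0_iff)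

lemma v_map_pt:
  assumes "\<not> (x = 0 \<and> y = 0 \<and> z = 0)" "a \<noteq> 0"
  shows "v_map a (pt x y z) = pt (x\<^sup>2) (y\<^sup>2) (a * z\<^sup>2)"
  using assms by (simp add: pt_def v_map.abs_eq proportional_refl_iff vector_3_eq_0_iff)

context
  notes [[typedef_overloaded]]
begin

datatype 'k omega = Pt "'k::field proj_plane" | New_u | New_v

end

fun mat_perm :: "'k::field ^ 3 ^ 3 \<Rightarrow> 'k omega \<Rightarrow> 'k omega" where
  "mat_perm A (Pt p) = Pt (mat_act A p)"
| "mat_perm A New_u = New_u"
| "mat_perm A New_v = New_v"

text \<open>\<open>PSL\<^sub>3\<close> as the permutation group induced by \<open>SL\<^sub>3\<close> on the plane, extended by fixing the
  two new points; the kernel of this action consists of the scalar matrices.\<close>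

definition PSL3_perms :: "('k::field omega \<Rightarrow> 'k omega) set" where
  "PSL3_perms = {mat_perm A | A. det A = 1}"

definition s_perm :: "'k::field omega \<Rightarrow> 'k omega" where
  "s_perm = mat_perm (vector [vector [1, 1, 0], vector [0, 1, 0], vector [0, 0, 1]])"

definition j_perm :: "'k::field omega \<Rightarrow> 'k omega" where
  "j_perm = mat_perm (vector [vector [0, 1, 0], vector [1, 0, 0], vector [0, 0, 1]])"

definition t_perm :: "'k::field omega \<Rightarrow> 'k omega" where
  "t_perm = mat_perm (vector [vector [0, 0, 1], vector [0, 1, 0], vector [1, 0, 0]])"

definition r_perm :: "'k::field \<Rightarrow> 'k omega \<Rightarrow> 'k omega" where
  "r_perm z = mat_perm (vector [vector [z, 0, 0], vector [0, 1, 0], vector [0, 0, inverse z]])"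

fun u_perm :: "'k::field omega \<Rightarrow> 'k omega" where
  "u_perm (Pt p) = (if p = pt 1 0 0 then New_u else Pt (u_map p))"
| "u_perm New_u = Pt (pt 1 0 0)"
| "u_perm New_v = New_v"

fun v_perm :: "'k::field \<Rightarrow> 'k omega \<Rightarrow> 'k omega" where
  "v_perm z (Pt p) = Pt (v_map z p)"
| "v_perm z New_u = New_v"
| "v_perm z New_v = New_u"

text \<open>The product of \<^term>\<open>BijGroup UNIV\<close> is composition from right to left.\<close>

definition M23 :: "'k::field \<Rightarrow> ('k omega \<Rightarrow> 'k omega) monoid" where
  "M23 z = (BijGroup UNIV)
     \<lparr>carrier := generate (BijGroup UNIV) (PSL3_perms \<union> {u_perm, v_perm z})\<rparr>"

end

theory Submission
  imports Defs
begin

text \<open>The given permutations satisfy the relations, by evaluation on the 23 points, so there is a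
  homomorphism \<open>\<phi>\<close> from the presented group \<open>P\<close> onto the group they generate. In \<open>P\<close>, conjugating \<open>s\<close> by
  words in \<open>j\<close>, \<open>t\<close>, \<open>r\<close> gives elements \<open>x\<^sub>i\<^sub>j(a)\<close>, \<open>a \<in> GF(4)\<close>, and the relations involving \<open>u\<close>
  and \<open>v\<close> together with \<open>(t s t j s)\<^sup>3 = 1\<close> imply the commutator relations of transvections. Let \<open>k = j t j\<close>
  and let \<open>U\<close> be generated by \<open>r\<close> and the \<open>x\<^sub>i\<^sub>j(a)\<close> with \<open>i < j\<close>. There is a chain of subgroups
  \<open>B = U \<union> U k U\<close>, \<open>H = B \<union> B j B\<close>, \<open>K = H \<union> H u H\<close>, \<open>P = K \<union> K v K\<close>: the first two unions
  are closed by the usual \<open>BN\<close>-pair computations, the third because \<open>u\<close> normalizes \<open>B\<close> and \<open>u j u = j u j\<close>,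
  the fourth because \<open>v\<close> normalizes \<open>H\<close> and \<open>v u v = u v u\<close>.

  Each of \<open>K\<close>, \<open>H\<close>, \<open>B\<close>, \<open>U\<close> stabilizes a set of points (the point \<open>v\<close>, the point \<open>u\<close>, the point
  \<open>[1,0,0]\<close>, the line \<open>z = 0\<close>) that is not preserved by the involution adjoined in the next step. Hence
  the kernel of \<open>\<phi>\<close> lies in \<open>U\<close>, where normal forms show that it is trivial. Gaussian elimination shows
  that \<open>PSL\<^sub>3(4)\<close> lies in the image.\<close>

section \<open>Presented groups\<close>

lemma normal_closure_normal:
  assumes "group G" "S \<subseteq> carrier G"
  shows "normal_closure G S \<lhd> G"
proof -
  interpret group G by fact
  let ?A = "{N. N \<lhd> G \<and> S \<subseteq> N}"
  \<comment> \<open>The whole group belongs to the family, so the intersection is over a nonempty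
    family of subgroups.\<close>
  have carrier: "carrier G \<in> ?A"
    using assms(2) normalI[OF subgroup_self] coset_join2 subgroup_self
    by (simp add: normal_inv_iff)
  then have ne: "?A \<noteq> {}" by blast
  have "subgroup (\<Inter> ?A) G"
    by (rule subgroups_Inter[OF _ ne]) (auto simp: normal_imp_subgroup)
  moreover have "x \<otimes>\<^bsub>G\<^esub> h \<otimes>\<^bsub>G\<^esub> inv\<^bsub>G\<^esub> x \<in> \<Inter> ?A"
    if "x \<in> carrier G" "h \<in> \<Inter> ?A" for x h
    using that by (auto intro: normal.inv_op_closed2)
  ultimately show ?thesis
    by (simp add: normal_inv_iff normal_closure_def)
qed

lemma normal_closure_superset: "S \<subseteq> normal_closure G S"
  by (auto simp: normal_closure_def)

lemma normal_closure_minimal: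
  assumes "N \<lhd> G" "S \<subseteq> N"
  shows "normal_closure G S \<subseteq> N"
  using assms by (auto simp: normal_closure_def)

section \<open>Homomorphisms out of a free group\<close>

definition eval_word :: "('g, 'c) monoid_scheme \<Rightarrow> ('a \<Rightarrow> 'g) \<Rightarrow> ('a \<times> bool) list \<Rightarrow> 'g" where
  "eval_word G f w =
     foldr (\<lambda>(a, b) x. (if b then f a else inv\<^bsub>G\<^esub> f a) \<otimes>\<^bsub>G\<^esub> x) w \<one>\<^bsub>G\<^esub>"

context group
begin

lemma eval_word_simps:
  "eval_word G f [] = \<one>"
  "eval_word G f ((a, b) # w) = (if b then f a else inv f a) \<otimes> eval_word G f w"
  by (simp_all add: eval_word_def)

lemma eval_word_closed:
  assumes "\<And>a. f a \<in> carrier G"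
  shows "eval_word G f w \<in> carrier G"
  by (induction w) (auto simp: eval_word_simps assms)

lemma eval_word_append:
  assumes "\<And>a. f a \<in> carrier G"
  shows "eval_word G f (w @ w') = eval_word G f w \<otimes> eval_word G f w'"
  by (induction w) (auto simp: eval_word_simps assms eval_word_closed m_assoc)

text \<open>Deleting or inserting an adjacent pair of inverse letters leaves the product in
  \<open>G\<close> unchanged, so evaluation descends to the free group.\<close>

lemma eval_word_equivclp:
  assumes "\<And>a. f a \<in> carrier G" "equivclp cancel w w'"
  shows "eval_word G f w = eval_word G f w'"
  using assms(2)
proof (induction rule: equivclp_induct)
  case base
  then show ?case by simp
next
  case (step y z)
  have "eval_word G f x = eval_word G f y" if "cancel x y" for x y
    using that
  proof cases
    case (1 xs a b ys)
    have "f a \<otimes> (inv f a \<otimes> z) = z" "inv f a \<otimes> (f a \<otimes> z) = z" if "z \<in> carrier G" for z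
      using that assms(1) by (simp_all flip: m_assoc)
    then show ?thesis
      using assms(1) by (simp add: 1 eval_word_append eval_word_simps eval_word_closed)
  qed
  with step show ?case by auto
qed

lemma free_group_hom_exists:
  fixes f :: "'c \<Rightarrow> 'a"
  assumes f: "\<And>a. f a \<in> carrier G"
  obtains h where "h \<in> hom free_group G" "\<And>a. h (free_gen a) = f a"
proof
  \<comment> \<open>An arbitrary representative word is evaluated; \<open>h_abs\<close> shows that
    the choice does not matter.\<close>
  define h where "h = (\<lambda>x. eval_word G f (rep_free_elem x))"
  have h_abs: "h (abs_free_elem w) = eval_word G f w" for w
    using Quotient3_rep_abs[OF Quotient3_free_elem, of w]
    by (auto simp: h_def intro: eval_word_equivclp[OF f])
  show "h \<in> hom free_group G"
  proof (rule homI)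
    show "h x \<in> carrier G" for x
      by (simp add: h_def eval_word_closed f)
    show "h (x \<otimes>\<^bsub>free_group\<^esub> y) = h x \<otimes> h y" for x y
      by (induction x rule: free_elem.abs_induct, induction y rule: free_elem.abs_induct)
        (simp add: free_group_def free_mult.abs_eq h_abs eval_word_append f)
  qed
  show "h (free_gen a) = f a" for a
    by (simp add: free_gen.abs_eq h_abs eval_word_simps f)
qed

end

lemma carrier_free_group [simp]: "x \<in> carrier free_group"
  by (simp add: free_group_def)

lemma free_group_generate: "generate free_group (range free_gen) = UNIV"
proof -
  interpret group free_group by (rule group_free_group)
  have "abs_free_elem w \<in> generate free_group (range free_gen)" for w :: "('a \<times> bool) list"
  proof (induction w)
    case Nil
    have "\<one>\<^bsub>free_group\<^esub> = (abs_free_elem [] :: 'a free_elem)"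
      by (simp add: free_group_def free_one.abs_eq)
    then show ?case by (metis generate.one)
  next
    case (Cons l w)
    obtain a b where l: "l = (a, b)" by (cases l)
    have mult: "abs_free_elem (x @ y) = abs_free_elem x \<otimes>\<^bsub>free_group\<^esub> abs_free_elem y"
      for x y :: "('a \<times> bool) list"
      by (simp add: free_group_def free_mult.abs_eq)
    \<comment> \<open>The letter \<open>(a, False)\<close> is an inverse only formally; cancelling
      it against \<open>(a, True)\<close> identifies its class with the group inverse of
      \<open>free_gen a\<close>.\<close>
    have "abs_free_elem [(a, False)] \<otimes>\<^bsub>free_group\<^esub> free_gen a = \<one>\<^bsub>free_group\<^esub>"
    proof -
      have "cancel [(a, False), (a, True)] []"
        using cancel.intros[of "[]" a False "[]"] by simp
      then show ?thesis
        by (auto simp: free_group_def free_mult.abs_eq free_gen.abs_eq free_one.abs_eq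
            free_elem.abs_eq_iff)
    qed
    then have "abs_free_elem [(a, False)] = inv\<^bsub>free_group\<^esub> free_gen a"
      by (metis carrier_free_group inv_equality)
    then have "abs_free_elem [l] \<in> generate free_group (range free_gen)"
      by (cases b) (auto simp: l intro: generate.inv generate.incl simp flip: free_gen.abs_eq)
    with Cons show ?case
      using mult[of "[l]" w] by (metis append_Cons append_Nil generate.eng)
  qed
  then have "x \<in> generate free_group (range free_gen)" for x :: "'a free_elem"
    by (induction x rule: free_elem.abs_induct)
  then show ?thesis by auto
qed

section \<open>The presented group and its universal property\<close>

lemma relators_normal: "normal_closure free_group (relators R) \<lhd> free_group"
  by (rule normal_closure_normal[OF group_free_group]) auto

lemma group_presented_group: "group (presented_group R)"
  unfolding presented_group_def by (rule normal.factorgroup_is_group[OF relators_normal])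

definition presented_class ::
    "('a free_elem \<times> 'a free_elem) set \<Rightarrow> 'a free_elem \<Rightarrow> 'a free_elem set" where
  "presented_class R w = normal_closure free_group (relators R) #>\<^bsub>free_group\<^esub> w"

lemma presented_class_hom: "group_hom free_group (presented_group R) (presented_class R)"
  using normal.r_coset_hom_Mod[OF relators_normal] group_free_group group_presented_group
  by (auto simp: group_hom_def group_hom_axioms_def presented_group_def presented_class_def[abs_def])

lemma presented_class_gen: "presented_class R (free_gen a) = presented_gen R a"
  by (simp add: presented_class_def presented_gen_def)

lemma carrier_presented_group: "carrier (presented_group R) = range (presented_class R)"
  by (simp add: presented_group_def carrier_FactGroup presented_class_def free_group_def)

lemma presented_gen_closed: "presented_gen R a \<in> carrier (presented_group R)"
  by (simp add: carrier_presented_group flip: presented_class_gen)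

lemma presented_group_generate:
  "generate (presented_group R) (range (presented_gen R)) = carrier (presented_group R)"
proof -
  interpret group_hom free_group "presented_group R" "presented_class R"
    by (rule presented_class_hom)
  have "presented_class R ` range free_gen = range (presented_gen R)"
    by (simp add: image_image presented_class_gen)
  with generate_img[of "range free_gen"] show ?thesis
    by (simp add: image_subset_iff free_group_generate carrier_presented_group)
qed

lemma presented_group_relation:
  assumes "(x, y) \<in> R"
  shows "presented_class R x = presented_class R y"
proof -
  interpret F: group free_group by (rule group_free_group)
  have "x \<otimes>\<^bsub>free_group\<^esub> inv\<^bsub>free_group\<^esub> y \<in> normal_closure free_group (relators R)"
    using assms normal_closure_superset[of "relators R"] by (auto simp: relators_def)
  then show ?thesis
    unfolding presented_class_def
    by (metis F.is_group F.repr_independence carrier_free_group normal_imp_subgroup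
        relators_normal subgroup.rcos_module_rev)
qed

text \<open>Von Dyck's theorem: the kernel of \<open>h\<close> is normal and contains the relators,
  hence their normal closure, so \<open>h\<close> factors through the quotient.\<close>

lemma (in group) presented_group_hom_exists:
  assumes h: "h \<in> hom free_group G" and R: "\<And>x y. (x, y) \<in> R \<Longrightarrow> h x = h y"
  obtains g where "g \<in> hom (presented_group R) G"
    "\<And>a. g (presented_gen R a) = h (free_gen a)"
proof -
  interpret h: group_hom free_group G h
    using h group_free_group is_group by (simp add: group_hom_def group_hom_axioms_def)
  have "relators R \<subseteq> kernel free_group G h"
    using R by (auto simp: relators_def kernel_def)
  then have "normal_closure free_group (relators R) \<subseteq> kernel free_group G h"
    by (rule normal_closure_minimal[OF h.normal_kernel])
  from h.FactGroup_universal_kernel[OF relators_normal this] obtain g where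
    "g \<in> hom (presented_group R) G"
    "\<And>x. x \<in> carrier free_group \<Longrightarrow> g (presented_class R x) = h x"
    unfolding presented_group_def presented_class_def by metis
  with that show thesis
    by (metis carrier_free_group presented_class_gen)
qed

lemma (in group_hom) hom_conj_by:
  assumes "x \<in> carrier G" "y \<in> carrier G"
  shows "h (x \<triangleleft>\<^bsub>G\<^esub> y) = h x \<triangleleft>\<^bsub>H\<^esub> h y"
  using assms by (simp add: conj_by_def)

lemma (in group) conj_by_closed [simp]:
  "x \<in> carrier G \<Longrightarrow> y \<in> carrier G \<Longrightarrow> x \<triangleleft> y \<in> carrier G"
  by (simp add: conj_by_def)

text \<open>The relations are built from group operations, so homomorphisms transport them. This
  serves both for the evaluation of free words as permutations and for the projection onto the
  presented group.\<close>

lemma (in group_hom) M23_relations_in_image: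
  assumes "s \<in> carrier G" "j \<in> carrier G" "t \<in> carrier G"
    "r \<in> carrier G" "u \<in> carrier G" "v \<in> carrier G"
  shows "M23_relations_in H (h s) (h j) (h t) (h r) (h u) (h v) =
    map_prod h h ` M23_relations_in G s j t r u v"
  using assms by (simp add: M23_relations_in_def hom_nat_pow hom_conj_by)

section \<open>The field with four elements\<close>

locale gf4 =
  fixes \<zeta> :: "'k::field"
  assumes card_field: "CARD('k) = 4" and primitive: "primitive_element \<zeta>"
begin

lemma range_powers: "range (\<lambda>n::nat. \<zeta> ^ n) = {x. x \<noteq> 0}"
  using primitive by (simp add: primitive_element_def)

lemma card_nonzero: "card {x :: 'k. x \<noteq> 0} = 3"
proof -
  have "finite (UNIV :: 'k set)" using card_field by (simp add: card_ge_0_finite)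
  moreover have "{x :: 'k. x \<noteq> 0} = UNIV - {0}" by auto
  ultimately show ?thesis using card_field by (simp add: card_Diff_singleton)
qed

lemma zeta_nonzero [simp]: "\<zeta> \<noteq> 0"
  using range_powers rangeI[of "\<lambda>n::nat. \<zeta> ^ n" 1] by auto

text \<open>By pigeonhole, two of the powers with exponents 0 to 3 coincide, so
  \<open>\<zeta> ^ d = 1\<close> for some positive \<open>d \<le> 3\<close>. A smaller
  \<open>d\<close> than 3 would leave fewer than three nonzero elements.\<close>

lemma zeta_cube: "\<zeta> ^ 3 = 1"
proof -
  have small: "d \<ge> 3" if "d > 0" "\<zeta> ^ d = 1" for d
  proof -
    have "range (\<lambda>n::nat. \<zeta> ^ n) \<subseteq> (\<lambda>n. \<zeta> ^ n) ` {..<d}"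
    proof
      fix x assume "x \<in> range (\<lambda>n::nat. \<zeta> ^ n)"
      then obtain n where "x = \<zeta> ^ n" by blast
      also have "\<dots> = \<zeta> ^ (d * (n div d) + n mod d)" by simp
      also have "\<dots> = \<zeta> ^ (n mod d)"
        using that by (simp only: power_add power_mult) simp
      finally show "x \<in> (\<lambda>n. \<zeta> ^ n) ` {..<d}" using that by auto
    qed
    then have "card {x :: 'k. x \<noteq> 0} \<le> card ((\<lambda>n. \<zeta> ^ n) ` {..<d})"
      by (metis card_mono finite_imageI finite_lessThan range_powers)
    also have "\<dots> \<le> d" using card_image_le[of "{..<d}" "\<lambda>n. \<zeta> ^ n"] by simp
    finally show ?thesis by (simp add: card_nonzero)
  qed
  have "(\<lambda>n. \<zeta> ^ n) ` {..3} \<subseteq> {x. x \<noteq> 0}" by auto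
  then have "card ((\<lambda>n. \<zeta> ^ n) ` {..3::nat}) \<le> 3"
    by (metis card_mono card_nonzero card.infinite zero_neq_numeral)
  then have "\<not> inj_on (\<lambda>n. \<zeta> ^ n) {..3::nat}"
    by (metis card_image card_atMost Suc_n_not_le_n numeral_3_eq_3)
  then obtain m n :: nat where mn: "m < n" "n \<le> 3" "\<zeta> ^ m = \<zeta> ^ n"
    unfolding inj_on_def by (metis atMost_iff linorder_neqE_nat)
  have "\<zeta> ^ m * \<zeta> ^ (n - m) = \<zeta> ^ (m + (n - m))" by (simp only: power_add)
  with mn have "\<zeta> ^ m * \<zeta> ^ (n - m) = \<zeta> ^ m * 1" by simp
  then have "\<zeta> ^ (n - m) = 1" by (metis mult_left_cancel power_not_zero zeta_nonzero)
  with small[of "n - m"] mn have "n - m = 3" by simp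
  with \<open>\<zeta> ^ (n - m) = 1\<close> show ?thesis by simp
qed

lemma zeta_power_mod: "\<zeta> ^ (n mod 3) = \<zeta> ^ n"
proof -
  have "\<zeta> ^ n = \<zeta> ^ (3 * (n div 3) + n mod 3)" by simp
  also have "\<dots> = \<zeta> ^ (n mod 3)"
    by (simp only: power_add power_mult zeta_cube) simp
  finally show ?thesis ..
qed

lemma nonzero_powers: "{x. x \<noteq> 0} = {1, \<zeta>, \<zeta>\<^sup>2}"
proof -
  have "\<zeta> ^ n \<in> {1, \<zeta>, \<zeta>\<^sup>2}" for n :: nat
  proof -
    have "n mod 3 = 0 \<or> n mod 3 = 1 \<or> n mod 3 = 2" by linarith
    then show ?thesis by (metis insertCI power_0 power_one_right zeta_power_mod)
  qed
  moreover have "{1, \<zeta>, \<zeta>\<^sup>2} \<subseteq> {x. x \<noteq> 0}" by auto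
  ultimately show ?thesis unfolding range_powers[symmetric] by blast
qed

lemma zeta_neq_one [simp]: "\<zeta> \<noteq> 1"
proof
  assume "\<zeta> = 1"
  then have "{x :: 'k. x \<noteq> 0} = {1}" using nonzero_powers by simp
  then show False using card_nonzero by simp
qed

text \<open>Factoring \<open>\<zeta> ^ 3 - 1\<close> gives
  \<open>\<zeta> * \<zeta> + \<zeta> + 1 = 0\<close>. Locating \<open>-1\<close> among the powers of
  \<open>\<zeta>\<close> then forces \<open>-1 = 1\<close>, that is, characteristic two.\<close>

lemma zeta_square: "\<zeta> * \<zeta> = \<zeta> + 1"
  and add_self: "(x :: 'k) + x = 0"
proof -
  have cube: "\<zeta> * (\<zeta> * \<zeta>) = 1" using zeta_cube by (simp add: power3_eq_cube mult.assoc)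
  have "(\<zeta> - 1) * (\<zeta> * \<zeta> + \<zeta> + 1) = 0" using cube by (simp add: algebra_simps)
  then have sum: "\<zeta> * \<zeta> + \<zeta> + 1 = 0" by (metis eq_iff_diff_eq_0 mult_eq_0_iff zeta_neq_one)
  have "(-1 :: 'k) \<in> {x. x \<noteq> 0}" by simp
  then consider "(-1 :: 'k) = 1" | "-1 = \<zeta>" | "-1 = \<zeta> * \<zeta>"
    unfolding nonzero_powers by (auto simp: power2_eq_square)
  then have "(-1 :: 'k) = 1"
  proof cases
    case 2
    then have "\<zeta> = -1" by simp
    with cube show ?thesis by simp
  next
    case 3
    have "\<zeta> = 0" using sum unfolding 3[symmetric] by simp
    then show ?thesis by simp
  qed simp
  then have two: "(1 :: 'k) + 1 = 0" by (metis add.right_inverse)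
  have "x + x = (1 + 1) * x" by (simp add: algebra_simps)
  then show self: "x + x = 0" for x :: 'k using two
    by (metis mult_2 mult_zero_left one_add_one)
  have "\<zeta> * \<zeta> + (\<zeta> + 1) = (\<zeta> + 1) + (\<zeta> + 1)"
    using sum by (simp only: self add.assoc)
  then show "\<zeta> * \<zeta> = \<zeta> + 1" by (simp only: add_right_cancel)
qed

lemma minus_self: "- x = (x :: 'k)"
  using add_self[of x] by (metis add_eq_0_iff)

lemma field_cases: "(x :: 'k) = 0 \<or> x = 1 \<or> x = \<zeta> \<or> x = \<zeta> + 1"
  using nonzero_powers zeta_square by (auto simp: power2_eq_square)

lemma add_self_left: "(x :: 'k) + (x + y) = y"
  by (simp add: add_self flip: add.assoc)

lemma zeta_plus_one_nonzero [simp]: "\<zeta> + 1 \<noteq> 0" "1 + \<zeta> \<noteq> 0"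
  using minus_self[of 1] zeta_neq_one by (metis add_eq_0_iff add.commute)+

lemma zeta_square_left: "\<zeta> * (\<zeta> * x) = \<zeta> * x + x"
  by (simp add: zeta_square algebra_simps flip: mult.assoc)

lemma inverse_zeta: "inverse \<zeta> = \<zeta> + 1" "inverse (\<zeta> + 1) = \<zeta>"
  by (rule inverse_unique, simp add: algebra_simps zeta_square zeta_square_left add_self add_self_left)+

lemmas gf4_simps = algebra_simps zeta_square zeta_square_left add_self add_self_left minus_self
  inverse_zeta power2_eq_square

end

section \<open>Extending a subgroup by an involution\<close>

context group
begin

text \<open>Since \<open>C\<close> normalizes \<open>A\<close>, the product of \<open>a c\<close>
  and \<open>b d\<close> is \<open>a (c b inv c)\<close> times \<open>c d\<close>. Iteration builds
  \<open>borel\<close> factor by factor.\<close>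

lemma subgroup_set_mult:
  assumes A: "subgroup A G" and C: "subgroup C G"
    and conj: "\<And>a c. a \<in> A \<Longrightarrow> c \<in> C \<Longrightarrow> c \<otimes> a \<otimes> inv c \<in> A"
  shows "subgroup (A <#> C) G"
proof (rule subgroupI)
  note [simp] = subgroup.mem_carrier[OF A] subgroup.mem_carrier[OF C]
  show "A <#> C \<subseteq> carrier G" by (auto simp: set_mult_def)
  show "A <#> C \<noteq> {}"
    using subgroup.one_closed[OF A] subgroup.one_closed[OF C] by (auto simp: set_mult_def)
  fix x assume "x \<in> A <#> C"
  then obtain a c where x: "x = a \<otimes> c" and ac: "a \<in> A" "c \<in> C" by (auto simp: set_mult_def)
  have "inv x = (inv c \<otimes> inv a \<otimes> inv (inv c)) \<otimes> inv c"
    using ac by (simp add: x m_assoc inv_mult_group)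
  moreover have "inv c \<otimes> inv a \<otimes> inv (inv c) \<in> A" "inv c \<in> C"
    using ac conj A C by (blast intro: subgroup.m_inv_closed)+
  ultimately show "inv x \<in> A <#> C" by (auto simp: set_mult_def)
  fix y assume "y \<in> A <#> C"
  then obtain b d where y: "y = b \<otimes> d" and bd: "b \<in> A" "d \<in> C" by (auto simp: set_mult_def)
  have "x \<otimes> y = (a \<otimes> (c \<otimes> b \<otimes> inv c)) \<otimes> (c \<otimes> d)"
    using ac bd by (simp add: x y m_assoc inv_solve_left)
  moreover have "a \<otimes> (c \<otimes> b \<otimes> inv c) \<in> A" "c \<otimes> d \<in> C"
    using ac bd conj A C by (blast intro: subgroup.m_closed)+
  ultimately show "x \<otimes> y \<in> A <#> C" by (auto simp: set_mult_def)
qed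

end

definition double_coset_union :: "('a, 'b) monoid_scheme \<Rightarrow> 'a set \<Rightarrow> 'a \<Rightarrow> 'a set" where
  "double_coset_union G S x = S \<union> {a \<otimes>\<^bsub>G\<^esub> x \<otimes>\<^bsub>G\<^esub> b | a b. a \<in> S \<and> b \<in> S}"

lemma double_coset_unionI:
  "a \<in> S \<Longrightarrow> a \<in> double_coset_union G S x"
  "a \<in> S \<Longrightarrow> b \<in> S \<Longrightarrow> a \<otimes>\<^bsub>G\<^esub> x \<otimes>\<^bsub>G\<^esub> b \<in> double_coset_union G S x"
  by (auto simp: double_coset_union_def)

lemma double_coset_unionE:
  assumes "g \<in> double_coset_union G S x"
  obtains "g \<in> S" | a b where "a \<in> S" "b \<in> S" "g = a \<otimes>\<^bsub>G\<^esub> x \<otimes>\<^bsub>G\<^esub> b"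
  using assms by (auto simp: double_coset_union_def)

context group
begin

lemma double_coset_union_mult:
  assumes S: "subgroup S G" and x: "x \<in> carrier G" and a: "a \<in> S"
    and g: "g \<in> double_coset_union G S x"
  shows "a \<otimes> g \<in> double_coset_union G S x" "g \<otimes> a \<in> double_coset_union G S x"
proof -
  note [simp] = subgroup.mem_carrier[OF S]
  have closed: "b \<otimes> c \<in> S" if "b \<in> S" "c \<in> S" for b c
    using that S by (blast intro: subgroup.m_closed)
  from g show "a \<otimes> g \<in> double_coset_union G S x"
  proof (cases rule: double_coset_unionE)
    case (2 b c)
    then have "a \<otimes> g = (a \<otimes> b) \<otimes> x \<otimes> c" using a x by (simp add: m_assoc)
    then show ?thesis using 2 a by (simp add: double_coset_unionI closed)
  qed (simp add: double_coset_unionI closed a)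
  from g show "g \<otimes> a \<in> double_coset_union G S x"
  proof (cases rule: double_coset_unionE)
    case (2 b c)
    then have "g \<otimes> a = b \<otimes> x \<otimes> (c \<otimes> a)" using a x by (simp add: m_assoc)
    then show ?thesis using 2 a by (simp add: double_coset_unionI closed)
  qed (simp add: double_coset_unionI closed a)
qed

text \<open>In the product of \<open>a x b\<close> and \<open>c x d\<close> only the middle part
  \<open>x (b c) x\<close> has to be controlled, which is what \<open>step\<close> does. Every level
  of the chain above \<open>borel\<close> comes from this lemma.\<close>

lemma subgroup_double_coset_union:
  assumes S: "subgroup S G" and x: "x \<in> carrier G" "x \<otimes> x = \<one>"
    and step: "\<And>b. b \<in> S \<Longrightarrow> x \<otimes> b \<otimes> x \<in> double_coset_union G S x"
  shows "subgroup (double_coset_union G S x) G" (is "subgroup ?D G")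
proof (rule subgroupI)
  note [simp] = subgroup.mem_carrier[OF S]
  have inv_x: "inv x = x" using x by (metis inv_equality)
  show "?D \<subseteq> carrier G" using x by (auto simp: double_coset_union_def)
  show "?D \<noteq> {}" using subgroup.one_closed[OF S] by (auto simp: double_coset_union_def)
  fix g assume g: "g \<in> ?D"
  have "inv a \<in> S" if "a \<in> S" for a using that S by (rule subgroup.m_inv_closed[rotated])
  with g x show "inv g \<in> ?D"
    by (elim double_coset_unionE) (simp_all add: double_coset_unionI inv_mult_group inv_x flip: m_assoc)
  fix h assume h: "h \<in> ?D"
  from g show "g \<otimes> h \<in> ?D"
  proof (cases rule: double_coset_unionE)
    case 1
    then show ?thesis by (intro double_coset_union_mult S x h)
  next
    case (2 a b)
    note ab = this
    from h show ?thesis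
    proof (cases rule: double_coset_unionE)
      case 1
      then show ?thesis by (intro double_coset_union_mult S x g)
    next
      case (2 c d)
      have "b \<otimes> c \<in> S" using ab 2 S by (blast intro: subgroup.m_closed)
      then have "x \<otimes> (b \<otimes> c) \<otimes> x \<in> ?D" by (rule step)
      then have "a \<otimes> (x \<otimes> (b \<otimes> c) \<otimes> x) \<in> ?D"
        by (rule double_coset_union_mult(1)[OF S x(1) ab(1)])
      then have "a \<otimes> (x \<otimes> (b \<otimes> c) \<otimes> x) \<otimes> d \<in> ?D"
        by (rule double_coset_union_mult(2)[OF S x(1) 2(2)])
      then show ?thesis using ab 2 x by (simp add: m_assoc)
    qed
  qed
qed

text \<open>With this, the inclusion of a conjugate in \<open>S\<close> can be tested on
  generators.\<close>

lemma subgroup_conj_preimage: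
  assumes S: "subgroup S G" and x: "x \<in> carrier G" "x \<otimes> x = \<one>"
  shows "subgroup {g \<in> carrier G. x \<otimes> g \<otimes> x \<in> S} G"
proof -
  have inv_x: "inv x = x" using x by (metis inv_equality)
  have xx: "x \<otimes> (x \<otimes> y) = y" if "y \<in> carrier G" for y
    using x that by (simp flip: m_assoc)
  show ?thesis
  proof (rule subgroupI)
    show "{g \<in> carrier G. x \<otimes> g \<otimes> x \<in> S} \<noteq> {}"
      using x subgroup.one_closed[OF S] by (auto intro!: exI[of _ \<one>])
  next
    fix g assume g: "g \<in> {g \<in> carrier G. x \<otimes> g \<otimes> x \<in> S}"
    then have "inv (x \<otimes> g \<otimes> x) \<in> S" using S by (auto intro: subgroup.m_inv_closed)
    then show "inv g \<in> {g \<in> carrier G. x \<otimes> g \<otimes> x \<in> S}"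
      using g x by (simp add: inv_mult_group inv_x m_assoc)
    fix h assume h: "h \<in> {g \<in> carrier G. x \<otimes> g \<otimes> x \<in> S}"
    have "(x \<otimes> g \<otimes> x) \<otimes> (x \<otimes> h \<otimes> x) \<in> S"
      using g h S by (blast intro: subgroup.m_closed)
    then show "g \<otimes> h \<in> {g \<in> carrier G. x \<otimes> g \<otimes> x \<in> S}"
      using g h x by (simp add: m_assoc xx)
  qed auto
qed

end

section \<open>Root elements in a group satisfying the relations\<close>

locale M23_group = gf4 \<zeta> + group G
  for \<zeta> :: "'k::field" and G :: "('a, 'b) monoid_scheme" (structure) +
  fixes s j t r u v
  assumes generated: "generate G {s, j, t, r, u, v} = carrier G"
    and gens_closed [simp]: "s \<in> carrier G" "j \<in> carrier G" "t \<in> carrier G"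
      "r \<in> carrier G" "u \<in> carrier G" "v \<in> carrier G"
    and relations: "\<And>x y. (x, y) \<in> M23_relations_in G s j t r u v \<Longrightarrow> x = y"
begin

text \<open>Products are normalized to right-nested form, so each rewrite rule for
  \<open>a \<otimes> b\<close> also needs a version with a tail \<open>x\<close>.\<close>

lemma assoc_left: "a \<otimes> b = c \<Longrightarrow> a \<in> carrier G \<Longrightarrow> b \<in> carrier G \<Longrightarrow> x \<in> carrier G \<Longrightarrow>
    a \<otimes> (b \<otimes> x) = c \<otimes> x"
  by (simp flip: m_assoc)

lemma involution_inv: "x \<in> carrier G \<Longrightarrow> x [^] (2::nat) = \<one> \<Longrightarrow> inv x = x"
  by (metis inv_equality nat_pow_Suc2 numeral_2_eq_2 nat_pow_0 r_one)

section \<open>The relations as rewrite rules\<close>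

lemma defining_relations:
  "r [^] (3::nat) = \<one>"
  "(j \<otimes> r) [^] (2::nat) = \<one>" "(t \<otimes> r) [^] (2::nat) = \<one>" "(v \<otimes> r) [^] (2::nat) = \<one>"
  "(u \<otimes> s) [^] (2::nat) = \<one>" "(v \<otimes> s) [^] (2::nat) = \<one>" "(v \<otimes> j) [^] (2::nat) = \<one>"
  "(t \<otimes> j) [^] (3::nat) = \<one>" "(j \<otimes> s) [^] (3::nat) = \<one>"
  "(u \<otimes> j) [^] (3::nat) = \<one>" "(v \<otimes> u) [^] (3::nat) = \<one>"
  "(s \<otimes> r) [^] (3::nat) = \<one>" "(t \<otimes> s \<otimes> t \<otimes> j \<otimes> s) [^] (3::nat) = \<one>"
  "r \<triangleleft> u = r \<triangleleft> j"
  "s \<triangleleft> (t \<otimes> u) = s \<otimes> (s \<triangleleft> t)"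
  "s \<triangleleft> (j \<otimes> t \<otimes> u) = (s \<triangleleft> (j \<otimes> t)) \<otimes> (s \<triangleleft> (t \<otimes> j \<otimes> t))"
  "s \<triangleleft> (t \<otimes> v) = s \<triangleleft> (t \<otimes> r)"
  "s \<triangleleft> (j \<otimes> t \<otimes> v) = s \<triangleleft> (j \<otimes> t \<otimes> r)"
  by (rule relations; simp only: M23_relations_in_def insert_iff simp_thms)+

lemma relation_squares: "s [^] (2::nat) = \<one>" "j [^] (2::nat) = \<one>" "t [^] (2::nat) = \<one>"
    "u [^] (2::nat) = \<one>" "v [^] (2::nat) = \<one>"
  by (rule relations; simp only: M23_relations_in_def insert_iff simp_thms)+

lemmas inv_gens [simp] = relation_squares[THEN involution_inv[rotated], simplified]

lemma square_gens [simp]: "s \<otimes> s = \<one>" "j \<otimes> j = \<one>" "t \<otimes> t = \<one>" "u \<otimes> u = \<one>" "v \<otimes> v = \<one>"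
  using r_inv[of s] r_inv[of j] r_inv[of t] r_inv[of u] r_inv[of v] by simp_all

lemmas square_gens_left [simp] = square_gens[THEN assoc_left, simplified]

abbreviation r' where "r' \<equiv> inv r"

lemma r_r' [simp]: "r \<otimes> r' = \<one>" "r' \<otimes> r = \<one>" by simp_all

lemmas r_r'_left [simp] = r_r'[THEN assoc_left, simplified]

lemma r_r [simp]: "r \<otimes> r = r'"
  using defining_relations(1)
    by (metis gens_closed(4) inv_equality m_closed m_assoc nat_pow_Suc nat_pow_0 l_one numeral_3_eq_3)

lemma r'_r' [simp]: "r' \<otimes> r' = r"
  by (metis r_r gens_closed(4) inv_inv inv_mult_group)

lemmas r_r_left [simp] = r_r[THEN assoc_left, simplified] r'_r'[THEN assoc_left, simplified]

text \<open>For \<open>y = r\<close> this says that \<open>x\<close> inverts the torus element; for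
  an involution \<open>y\<close> it says that \<open>x\<close> and \<open>y\<close> commute. Both
  readings occur below.\<close>

lemma involution_product_inverts:
  assumes [simp]: "x \<in> carrier G" "y \<in> carrier G"
    and "x \<otimes> x = \<one>" "(x \<otimes> y) [^] (2::nat) = \<one>"
  shows "y \<otimes> x = x \<otimes> inv y"
proof -
  have x: "inv x = x" using assms(3) by (metis inv_equality assms(1))
  have "inv (x \<otimes> y) = x \<otimes> y" using assms(4) by (simp add: involution_inv)
  then have xy: "x \<otimes> y = inv y \<otimes> x" by (simp add: inv_mult_group x)
  have "y \<otimes> x = y \<otimes> (x \<otimes> y) \<otimes> inv y" by (simp add: m_assoc)
  also have "\<dots> = x \<otimes> inv y" by (simp add: xy flip: m_assoc)
  finally show ?thesis .
qed

text \<open>Oriented so that powers of \<open>r\<close> move to the right. Together with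
  \<open>weyl_braid\<close>, which turns \<open>t j t\<close> into \<open>j t j\<close>,
  simplification normalizes words in \<open>j\<close>, \<open>t\<close> and
  \<open>r\<close>.\<close>

lemma torus_weyl [simp]: "r \<otimes> j = j \<otimes> r'" "r \<otimes> t = t \<otimes> r'" "r \<otimes> v = v \<otimes> r'"
  "r' \<otimes> j = j \<otimes> r" "r' \<otimes> t = t \<otimes> r" "r' \<otimes> v = v \<otimes> r"
proof -
  show *: "r \<otimes> j = j \<otimes> r'" "r \<otimes> t = t \<otimes> r'" "r \<otimes> v = v \<otimes> r'"
    using defining_relations(2-4) by (simp_all add: involution_product_inverts)
  have "r' \<otimes> x = x \<otimes> r" if "r \<otimes> x = x \<otimes> r'" "x \<in> carrier G" for x
  proof -
    have "r' \<otimes> (r \<otimes> x) \<otimes> r = r' \<otimes> (x \<otimes> r') \<otimes> r" using that by simp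
    then show ?thesis using that(2) by (simp add: m_assoc)
  qed
  with * show "r' \<otimes> j = j \<otimes> r" "r' \<otimes> t = t \<otimes> r" "r' \<otimes> v = v \<otimes> r" by simp_all
qed

lemmas torus_weyl_left [simp] = torus_weyl[THEN assoc_left, simplified, simplified m_assoc, simplified]

lemma cube_braid:
  assumes [simp]: "x \<in> carrier G" "y \<in> carrier G"
    and "x \<otimes> x = \<one>" "y \<otimes> y = \<one>" "(x \<otimes> y) [^] (3::nat) = \<one>"
  shows "x \<otimes> (y \<otimes> x) = y \<otimes> (x \<otimes> y)"
proof -
  have inv: "inv x = x" "inv y = y" using assms by (metis inv_equality)+
  have "x \<otimes> (y \<otimes> x) \<otimes> (y \<otimes> (x \<otimes> y)) = \<one>"
    using assms(5) by (simp add: numeral_3_eq_3 m_assoc)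
  then have "x \<otimes> (y \<otimes> x) = inv (y \<otimes> (x \<otimes> y))"
    by (intro inv_equality[symmetric]) simp_all
  then show ?thesis by (simp add: inv inv_mult_group m_assoc)
qed

lemma relation_cubes:
  "t \<otimes> (j \<otimes> t) = j \<otimes> (t \<otimes> j)" "j \<otimes> (s \<otimes> j) = s \<otimes> (j \<otimes> s)"
  "u \<otimes> (j \<otimes> u) = j \<otimes> (u \<otimes> j)" "v \<otimes> (u \<otimes> v) = u \<otimes> (v \<otimes> u)"
  by (intro cube_braid gens_closed square_gens defining_relations)+

lemmas weyl_braid [simp] = relation_cubes(1)

lemma weyl_braid_left [simp]: "x \<in> carrier G \<Longrightarrow> t \<otimes> (j \<otimes> (t \<otimes> x)) = j \<otimes> (t \<otimes> (j \<otimes> x))"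
  using relation_cubes(1)[THEN assoc_left, of x] by (simp add: m_assoc)

lemma relation_commute: "u \<otimes> s = s \<otimes> u" "v \<otimes> s = s \<otimes> v" "v \<otimes> j = j \<otimes> v"
  using defining_relations(5-7) by (metis inv_gens gens_closed involution_product_inverts square_gens)+

text \<open>Since \<open>r = diag(\<zeta>, 1, \<zeta>\<^sup>-\<^sup>1)\<close> multiplies the parameter of a transvection \<open>1 + a E\<^sub>1\<^sub>2\<close> by \<open>\<zeta>\<close>, the
  conjugates of \<open>s\<close> under \<open>r\<close> play the role of these transvections.\<close>

definition x12 :: "'k \<Rightarrow> 'a" where
  "x12 a = (if a = 0 then \<one> else if a = 1 then s else if a = \<zeta> then r \<otimes> (s \<otimes> r')
     else r' \<otimes> (s \<otimes> r))"

lemma x12_closed [simp]: "x12 a \<in> carrier G"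
  by (simp add: x12_def)

lemma x12_zero [simp]: "x12 0 = \<one>" and x12_one: "x12 1 = s"
  by (simp_all add: x12_def)

lemma x12_zeta: "x12 \<zeta> = r \<otimes> (s \<otimes> r')" "x12 (\<zeta> + 1) = r' \<otimes> (s \<otimes> r)"
  by (simp_all add: x12_def)

lemma x12_conj_r: "r \<otimes> x12 a = x12 (\<zeta> * a) \<otimes> r" "r' \<otimes> x12 a = x12 ((\<zeta> + 1) * a) \<otimes> r'"
  using field_cases[of a] by (auto simp: x12_def gf4_simps m_assoc)

text \<open>As \<open>r \<otimes> r = r'\<close>, the relation \<open>(s r)^3 = 1\<close> says that
  the product of the involutions \<open>s\<close>, \<open>B\<close> and \<open>C\<close> is 1.
  Together with 1 they form a Klein four-group, the additive group of the field.\<close>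

lemma x12_add: "x12 a \<otimes> x12 b = x12 (a + b)"
proof -
  define B where "B = r \<otimes> (s \<otimes> r')"
  define C where "C = r' \<otimes> (s \<otimes> r)"
  have [simp]: "B \<in> carrier G" "C \<in> carrier G" by (simp_all add: B_def C_def)
  have BB: "B \<otimes> B = \<one>" and CC: "C \<otimes> C = \<one>" by (simp_all add: B_def C_def m_assoc)
  have "s \<otimes> (B \<otimes> C) = \<one>"
    using defining_relations(12) by (simp add: B_def C_def m_assoc numeral_3_eq_3)
  then have sB: "s \<otimes> B = C" using CC
    by (metis \<open>B \<in> carrier G\<close> \<open>C \<in> carrier G\<close> gens_closed(1) inv_equality inv_inv m_assoc m_closed)
  have sC: "s \<otimes> C = B" by (simp flip: sB)
  have Bs: "B \<otimes> s = C"
    by (metis BB CC sB \<open>B \<in> carrier G\<close> \<open>C \<in> carrier G\<close> gens_closed(1) inv_equality inv_gens(1) inv_mult_group)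
  have BC: "B \<otimes> C = s" by (simp add: BB flip: Bs m_assoc)
  have Cs: "C \<otimes> s = B" by (simp add: m_assoc flip: Bs)
  have CB: "C \<otimes> B = s" by (simp add: BB m_assoc flip: sB)
  show ?thesis
    using field_cases[of a] field_cases[of b]
    by (auto simp: x12_def gf4_simps BB CC sB sC Bs BC Cs CB simp flip: B_def C_def)
qed

lemma x12_add_left: "x \<in> carrier G \<Longrightarrow> x12 a \<otimes> (x12 b \<otimes> x) = x12 (a + b) \<otimes> x"
  by (simp add: x12_add flip: m_assoc)

lemma j_x12_one: "j \<otimes> (x12 1 \<otimes> j) = x12 1 \<otimes> (j \<otimes> x12 1)"
  by (simp add: x12_one relation_cubes(2))

text \<open>The transvections \<open>1 + a E\<close> for the other matrix positions
  \<open>E\<close>: conjugation by the permutation matrices of \<open>j\<close> and \<open>t\<close>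
  moves the off-diagonal entry.\<close>

definition x21 where "x21 a = j \<otimes> (x12 a \<otimes> j)"
definition x32 where "x32 a = t \<otimes> (x12 a \<otimes> t)"
definition x31 where "x31 a = j \<otimes> (t \<otimes> (x12 a \<otimes> (t \<otimes> j)))"
definition x23 where "x23 a = t \<otimes> (j \<otimes> (x12 a \<otimes> (j \<otimes> t)))"
definition x13 where "x13 a = j \<otimes> (t \<otimes> (j \<otimes> (x12 a \<otimes> (j \<otimes> (t \<otimes> j)))))"

lemmas root_defs = x21_def x32_def x31_def x23_def x13_def

lemma root_closed [simp]: "x21 a \<in> carrier G" "x32 a \<in> carrier G" "x31 a \<in> carrier G"
  "x23 a \<in> carrier G" "x13 a \<in> carrier G"
  by (simp_all add: root_defs)

lemma root_zero [simp]: "x21 0 = \<one>" "x32 0 = \<one>" "x31 0 = \<one>" "x23 0 = \<one>" "x13 0 = \<one>"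
  by (simp_all add: root_defs)

lemma root_add: "x21 a \<otimes> x21 b = x21 (a + b)" "x32 a \<otimes> x32 b = x32 (a + b)"
  "x31 a \<otimes> x31 b = x31 (a + b)" "x23 a \<otimes> x23 b = x23 (a + b)" "x13 a \<otimes> x13 b = x13 (a + b)"
  by (simp_all add: root_defs m_assoc x12_add_left)

lemmas root_add_left = root_add[THEN assoc_left, simplified]

lemma root_self [simp]: "x12 a \<otimes> x12 a = \<one>" "x32 a \<otimes> x32 a = \<one>" "x31 a \<otimes> x31 a = \<one>"
  by (simp_all add: x12_add root_add add_self)

lemmas x12_conj_r_left = x12_conj_r[THEN assoc_left, simplified, simplified m_assoc, simplified]

text \<open>In position \<open>(i, j)\<close> the factor is the quotient of the diagonal entries
  \<open>i\<close> and \<open>j\<close> of \<open>r\<close>, where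
  \<open>inverse \<zeta> = \<zeta> + 1\<close>.\<close>

lemma root_conj_r: "r \<otimes> x21 a = x21 ((\<zeta> + 1) * a) \<otimes> r" "r \<otimes> x32 a = x32 ((\<zeta> + 1) * a) \<otimes> r"
  "r \<otimes> x31 a = x31 (\<zeta> * a) \<otimes> r" "r \<otimes> x23 a = x23 (\<zeta> * a) \<otimes> r"
  "r \<otimes> x13 a = x13 ((\<zeta> + 1) * a) \<otimes> r" "r' \<otimes> x13 a = x13 (\<zeta> * a) \<otimes> r'"
  "r' \<otimes> x23 a = x23 ((\<zeta> + 1) * a) \<otimes> r'"
  by (simp_all add: root_defs m_assoc x12_conj_r_left)

lemmas root_conj_r_left = root_conj_r[THEN assoc_left, simplified, simplified m_assoc, simplified]

text \<open>Outside position 12, \<open>v\<close> moves the parameter 1 to another value. This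
  supplies the second instance that \<open>torus_induct\<close> asks for.\<close>

lemma v_roots: "v \<otimes> x12 1 = x12 1 \<otimes> v" "v \<otimes> x32 1 = x32 \<zeta> \<otimes> v"
   "v \<otimes> x31 1 = x31 \<zeta> \<otimes> v" "v \<otimes> x23 1 = x23 (\<zeta> + 1) \<otimes> v"
proof -
  show "v \<otimes> x12 1 = x12 1 \<otimes> v" by (simp add: x12_one relation_commute)
  have "v \<otimes> (t \<otimes> (s \<otimes> (t \<otimes> v))) = t \<otimes> (x12 \<zeta> \<otimes> t)"
    using defining_relations(17) by (simp add: conj_by_def inv_mult_group m_assoc x12_zeta)
  then have "v \<otimes> (t \<otimes> (s \<otimes> (t \<otimes> v))) \<otimes> v = t \<otimes> (x12 \<zeta> \<otimes> t) \<otimes> v" by simp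
  then show 32: "v \<otimes> x32 1 = x32 \<zeta> \<otimes> v" by (simp add: x32_def x12_one m_assoc)
  have "v \<otimes> (t \<otimes> (j \<otimes> (s \<otimes> (j \<otimes> (t \<otimes> v))))) = t \<otimes> (j \<otimes> (x12 (\<zeta> + 1) \<otimes> (j \<otimes> t)))"
    using defining_relations(18) by (simp add: conj_by_def inv_mult_group m_assoc x12_zeta)
  then have "v \<otimes> (t \<otimes> (j \<otimes> (s \<otimes> (j \<otimes> (t \<otimes> v))))) \<otimes> v =
      t \<otimes> (j \<otimes> (x12 (\<zeta> + 1) \<otimes> (j \<otimes> t))) \<otimes> v" by simp
  then show "v \<otimes> x23 1 = x23 (\<zeta> + 1) \<otimes> v" by (simp add: x23_def x12_one m_assoc)
  \<comment> \<open>As \<open>v\<close> commutes with \<open>j\<close>, the formula for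
    \<open>x31\<close> follows from that for \<open>x32\<close>.\<close>
  have 31: "x31 a = j \<otimes> (x32 a \<otimes> j)" for a by (simp add: x31_def x32_def m_assoc)
  have "v \<otimes> x31 1 = j \<otimes> ((v \<otimes> x32 1) \<otimes> j)"
    by (simp add: 31 relation_commute(3) m_assoc relation_commute(3)[THEN assoc_left, simplified])
  also have "\<dots> = x31 \<zeta> \<otimes> v" by (simp add: 31 32 m_assoc relation_commute(3))
  finally show "v \<otimes> x31 1 = x31 \<zeta> \<otimes> v" .
qed

lemma u_roots: "u \<otimes> (x32 1 \<otimes> u) = x12 1 \<otimes> x32 1" "u \<otimes> (x23 1 \<otimes> u) = x23 1 \<otimes> x13 1"
  using defining_relations(15,16)
  by (simp_all add: conj_by_def inv_mult_group m_assoc root_defs x12_one)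

section \<open>Commutator relations between root elements\<close>

lemma commuteI:
  assumes [simp]: "x \<in> carrier G" "y \<in> carrier G"
    and "x \<otimes> x = \<one>" "y \<otimes> y = \<one>" "(x \<otimes> y) \<otimes> (x \<otimes> y) = \<one>"
  shows "x \<otimes> y = y \<otimes> x"
  using assms by (metis inv_equality inv_mult_group m_closed)

text \<open>A relation between root elements that is additive in one parameter is obtained from two of
  its instances, by conjugation with the torus element \<open>r\<close>.\<close>

lemma torus_induct:
  assumes zero: "\<And>b. P 0 b" and "P 1 1" "P 1 b" "b \<noteq> 0" "b \<noteq> 1"
    and add: "\<And>b c. P 1 b \<Longrightarrow> P 1 c \<Longrightarrow> P 1 (b + c)"
    and torus: "\<And>a b. P a b \<Longrightarrow> P (\<zeta> * a) (c * b)" and c: "(c :: 'k) \<noteq> 0"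
  shows "P a d"
proof -
  have "P 1 0" using add[of 1 1] assms by (simp add: add_self)
  have "P 1 (1 + b)" using add[of 1 b] assms by simp
  have one: "P 1 d" for d
    using \<open>P 1 0\<close> \<open>P 1 1\<close> \<open>P 1 b\<close> \<open>P 1 (1 + b)\<close> \<open>b \<noteq> 0\<close> \<open>b \<noteq> 1\<close> field_cases[of b] field_cases[of d]
    by (auto simp: gf4_simps)
  have zeta: "P \<zeta> d" for d
    using torus[OF one, of "inverse c * d"] c by (simp flip: mult.assoc)
  have "P (\<zeta> + 1) d" for d
    using torus[OF zeta, of "inverse c * d"] c by (simp add: zeta_square flip: mult.assoc)
  with one zeta zero show ?thesis using field_cases[of a] by metis
qed

lemma conj_eqI:
  assumes "x \<otimes> y = y' \<otimes> x" "x \<otimes> z = z' \<otimes> x" "y = z"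
    "x \<in> carrier G" "y \<in> carrier G" "y' \<in> carrier G" "z' \<in> carrier G"
  shows "y' = z'"
  using assms by (metis right_cancel)

text \<open>The relation for \<open>s\<close> conjugated by \<open>t u\<close> says that the product of the involutions \<open>x12 1\<close> and
  \<open>x32 1\<close> is conjugate under \<open>u\<close> to one of them, hence is an involution; conjugation by \<open>v\<close> gives a
  second instance of the commutation.\<close>

lemma x12_x32_commute: "x12 a \<otimes> x32 b = x32 b \<otimes> x12 a"
proof (rule torus_induct[where P = "\<lambda>a b. x12 a \<otimes> x32 b = x32 b \<otimes> x12 a" and b = \<zeta> and c = "\<zeta> + 1"])
  have "x12 1 \<otimes> x32 1 \<otimes> (x12 1 \<otimes> x32 1) = (u \<otimes> (x32 1 \<otimes> u)) \<otimes> (u \<otimes> (x32 1 \<otimes> u))"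
    by (simp add: u_roots)
  also have "\<dots> = \<one>" by (simp add: m_assoc root_add_left add_self)
  finally show one: "x12 1 \<otimes> x32 1 = x32 1 \<otimes> x12 1" by (intro commuteI) simp_all
  have "v \<otimes> (x12 1 \<otimes> x32 1) = x12 1 \<otimes> x32 \<zeta> \<otimes> v"
    by (metis m_assoc v_roots gens_closed(6) x12_closed root_closed(2))
  moreover have "v \<otimes> (x32 1 \<otimes> x12 1) = x32 \<zeta> \<otimes> x12 1 \<otimes> v"
    by (metis m_assoc v_roots gens_closed(6) x12_closed root_closed(2))
  ultimately show "x12 1 \<otimes> x32 \<zeta> = x32 \<zeta> \<otimes> x12 1"
    using one by (auto elim: conj_eqI)
next
  fix b c assume "x12 1 \<otimes> x32 b = x32 b \<otimes> x12 1" "x12 1 \<otimes> x32 c = x32 c \<otimes> x12 1"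
  then show "x12 1 \<otimes> x32 (b + c) = x32 (b + c) \<otimes> x12 1"
    by (metis m_assoc root_add(2) x12_closed root_closed(2))
next
  fix a b assume eq: "x12 a \<otimes> x32 b = x32 b \<otimes> x12 a"
  have "r \<otimes> (x12 a \<otimes> x32 b) = x12 (\<zeta> * a) \<otimes> x32 ((\<zeta> + 1) * b) \<otimes> r"
    "r \<otimes> (x32 b \<otimes> x12 a) = x32 ((\<zeta> + 1) * b) \<otimes> x12 (\<zeta> * a) \<otimes> r"
    by (simp_all add: x12_conj_r_left root_conj_r_left m_assoc x12_conj_r root_conj_r)
  with eq show "x12 (\<zeta> * a) \<otimes> x32 ((\<zeta> + 1) * b) = x32 ((\<zeta> + 1) * b) \<otimes> x12 (\<zeta> * a)"
    by (auto elim: conj_eqI)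
qed simp_all

text \<open>With \<open>a = x32 1\<close> commuting with \<open>s\<close>, the relation \<open>(a j s)\<^sup>3 = 1\<close> says that the involutions \<open>a\<close>,
  \<open>j a j\<close> and \<open>s (j a j) s\<close> have product 1, so that they span a Klein four-group.\<close>

lemma x31_x32_one:
  "x32 1 \<otimes> x31 1 = x31 1 \<otimes> x32 1"
  "x12 1 \<otimes> x31 1 = x31 1 \<otimes> x32 1 \<otimes> x12 1"
proof -
  let ?a = "x32 1" and ?b = "x31 1"
  have sa: "s \<otimes> (?a \<otimes> y) = ?a \<otimes> (s \<otimes> y)" if "y \<in> carrier G" for y
    using x12_x32_commute[of 1 1] that by (simp add: x12_one flip: m_assoc)
  have b: "?b = j \<otimes> (?a \<otimes> j)" by (simp add: x31_def x32_def m_assoc)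
  have "?a \<otimes> (?b \<otimes> (s \<otimes> (?b \<otimes> s))) =
      ?a \<otimes> (j \<otimes> (?a \<otimes> ((j \<otimes> (s \<otimes> j)) \<otimes> (?a \<otimes> (j \<otimes> s)))))"
    by (simp add: b m_assoc)
  also have "\<dots> = ?a \<otimes> (j \<otimes> (s \<otimes> (?a \<otimes> (j \<otimes> (s \<otimes> (?a \<otimes> (j \<otimes> s)))))))"
    by (simp add: relation_cubes(2) m_assoc sa)
  also have "\<dots> = \<one>"
    using defining_relations(13) by (simp add: x32_def x12_one m_assoc numeral_3_eq_3)
  finally have eq: "(?a \<otimes> ?b) \<otimes> (s \<otimes> (?b \<otimes> s)) = \<one>" by (simp add: m_assoc)
  have inv: "inv ?a = ?a" "inv ?b = ?b" by (metis inv_equality root_self root_closed)+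
  have "s \<otimes> (?b \<otimes> s) = inv (?a \<otimes> ?b)"
    using eq by (metis gens_closed(1) inv_equality inv_inv m_closed root_closed(2,3))
  then have sbs: "s \<otimes> (?b \<otimes> s) = ?b \<otimes> ?a" by (simp add: inv inv_mult_group)
  have "(?b \<otimes> ?a) \<otimes> (?b \<otimes> ?a) = s \<otimes> (?b \<otimes> s) \<otimes> (s \<otimes> (?b \<otimes> s))" by (simp add: sbs)
  also have "\<dots> = \<one>" by (simp add: m_assoc root_add_left add_self)
  finally show "?a \<otimes> ?b = ?b \<otimes> ?a" by (metis commuteI root_closed(2,3) root_self(2,3))
  have "s \<otimes> (?b \<otimes> s) \<otimes> s = ?b \<otimes> ?a \<otimes> s" by (simp add: sbs)
  then show "x12 1 \<otimes> ?b = ?b \<otimes> ?a \<otimes> x12 1" by (simp add: x12_one m_assoc)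
qed

text \<open>Conjugation by \<open>v\<close> takes the instance with parameters \<open>(1, 1)\<close>
  to \<open>(\<zeta>, \<zeta>)\<close>, and the torus takes that to
  \<open>(1, \<zeta> + 1)\<close>.\<close>

lemma x32_x31_commute: "x32 a \<otimes> x31 b = x31 b \<otimes> x32 a"
proof (rule torus_induct[where P = "\<lambda>a b. x32 a \<otimes> x31 b = x31 b \<otimes> x32 a" and b = "\<zeta> + 1" and c = "\<zeta> + 1"])
  show "x32 1 \<otimes> x31 1 = x31 1 \<otimes> x32 1" by (rule x31_x32_one)
  have torus: "x32 ((\<zeta> + 1) * a) \<otimes> x31 (\<zeta> * b) = x31 (\<zeta> * b) \<otimes> x32 ((\<zeta> + 1) * a)"
    if "x32 a \<otimes> x31 b = x31 b \<otimes> x32 a" for a b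
  proof -
    have "r \<otimes> (x32 a \<otimes> x31 b) = x32 ((\<zeta> + 1) * a) \<otimes> x31 (\<zeta> * b) \<otimes> r"
      "r \<otimes> (x31 b \<otimes> x32 a) = x31 (\<zeta> * b) \<otimes> x32 ((\<zeta> + 1) * a) \<otimes> r"
      by (simp_all add: root_conj_r_left m_assoc root_conj_r)
    with that show ?thesis by (auto elim: conj_eqI)
  qed
  \<comment> \<open>Conjugation by \<open>r\<close> multiplies \<open>a\<close> by
    \<open>\<zeta> + 1\<close>; only its square multiplies it by \<open>\<zeta>\<close>, as
    \<open>torus_induct\<close> requires.\<close>
  show "x32 (\<zeta> * a) \<otimes> x31 ((\<zeta> + 1) * b) = x31 ((\<zeta> + 1) * b) \<otimes> x32 (\<zeta> * a)"
    if "x32 a \<otimes> x31 b = x31 b \<otimes> x32 a" for a b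
    using torus[OF torus[OF that]] by (simp add: gf4_simps)
  have "v \<otimes> (x32 1 \<otimes> x31 1) = x32 \<zeta> \<otimes> x31 \<zeta> \<otimes> v"
    by (metis m_assoc v_roots gens_closed(6) root_closed(2,3))
  moreover have "v \<otimes> (x31 1 \<otimes> x32 1) = x31 \<zeta> \<otimes> x32 \<zeta> \<otimes> v"
    by (metis m_assoc v_roots gens_closed(6) root_closed(2,3))
  ultimately have "x32 \<zeta> \<otimes> x31 \<zeta> = x31 \<zeta> \<otimes> x32 \<zeta>"
    using x31_x32_one(1) by (auto elim: conj_eqI)
  from torus[OF this] show "x32 1 \<otimes> x31 (\<zeta> + 1) = x31 (\<zeta> + 1) \<otimes> x32 1"
    by (simp add: gf4_simps)
next
  fix b c assume "x32 1 \<otimes> x31 b = x31 b \<otimes> x32 1" "x32 1 \<otimes> x31 c = x31 c \<otimes> x32 1"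
  then show "x32 1 \<otimes> x31 (b + c) = x31 (b + c) \<otimes> x32 1"
    by (metis m_assoc root_add(3) root_closed(2,3))
qed simp_all

text \<open>Because \<open>x32\<close> and \<open>x31\<close> commute, the relation is additive in
  \<open>b\<close>. Conjugation by \<open>r\<close> scales \<open>a\<close> and \<open>b\<close> by
  \<open>\<zeta>\<close> and the parameter of \<open>x32\<close> by
  \<open>\<zeta> + 1 = \<zeta> * \<zeta>\<close>, consistently with the product
  \<open>a * b\<close>.\<close>

lemma x12_x31_commutator: "x12 a \<otimes> x31 b = x31 b \<otimes> x32 (a * b) \<otimes> x12 a"
proof (rule torus_induct[where P = "\<lambda>a b. x12 a \<otimes> x31 b = x31 b \<otimes> x32 (a * b) \<otimes> x12 a"
      and b = \<zeta> and c = \<zeta>])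
  show "x12 1 \<otimes> x31 1 = x31 1 \<otimes> x32 (1 * 1) \<otimes> x12 1" using x31_x32_one(2) by simp
  have "v \<otimes> (x12 1 \<otimes> x31 1) = x12 1 \<otimes> x31 \<zeta> \<otimes> v"
    by (metis m_assoc v_roots gens_closed(6) x12_closed root_closed(2,3))
  moreover have "v \<otimes> (x31 1 \<otimes> x32 1 \<otimes> x12 1) = x31 \<zeta> \<otimes> x32 \<zeta> \<otimes> x12 1 \<otimes> v"
    by (simp add: m_assoc v_roots v_roots[THEN assoc_left])
  ultimately show "x12 1 \<otimes> x31 \<zeta> = x31 \<zeta> \<otimes> x32 (1 * \<zeta>) \<otimes> x12 1"
    using x31_x32_one(2) by (auto elim: conj_eqI)
next
  fix b c
  assume b: "x12 1 \<otimes> x31 b = x31 b \<otimes> x32 (1 * b) \<otimes> x12 1"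
    and c: "x12 1 \<otimes> x31 c = x31 c \<otimes> x32 (1 * c) \<otimes> x12 1"
  have "x12 1 \<otimes> x31 (b + c) = (x12 1 \<otimes> x31 b) \<otimes> x31 c"
    by (simp add: m_assoc root_add)
  also have "\<dots> = x31 b \<otimes> (x32 b \<otimes> (x31 c \<otimes> (x32 c \<otimes> x12 1)))"
    using c by (simp add: b m_assoc)
  also have "\<dots> = x31 (b + c) \<otimes> x32 (b + c) \<otimes> x12 1"
    by (simp add: x32_x31_commute[THEN assoc_left] m_assoc root_add_left)
  finally show "x12 1 \<otimes> x31 (b + c) = x31 (b + c) \<otimes> x32 (1 * (b + c)) \<otimes> x12 1" by simp
next
  fix a b assume eq: "x12 a \<otimes> x31 b = x31 b \<otimes> x32 (a * b) \<otimes> x12 a"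
  have "r \<otimes> (x12 a \<otimes> x31 b) = x12 (\<zeta> * a) \<otimes> x31 (\<zeta> * b) \<otimes> r"
    by (simp_all add: x12_conj_r_left root_conj_r_left m_assoc x12_conj_r root_conj_r)
  moreover have "r \<otimes> (x31 b \<otimes> x32 (a * b) \<otimes> x12 a) =
      x31 (\<zeta> * b) \<otimes> x32 ((\<zeta> + 1) * (a * b)) \<otimes> x12 (\<zeta> * a) \<otimes> r"
    by (simp add: x12_conj_r_left root_conj_r_left m_assoc x12_conj_r root_conj_r)
  ultimately have "x12 (\<zeta> * a) \<otimes> x31 (\<zeta> * b) =
      x31 (\<zeta> * b) \<otimes> x32 ((\<zeta> + 1) * (a * b)) \<otimes> x12 (\<zeta> * a)"
    using eq by (auto elim: conj_eqI)
  moreover have "(\<zeta> + 1) * (a * b) = \<zeta> * a * (\<zeta> * b)" by (simp add: gf4_simps)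
  ultimately show "x12 (\<zeta> * a) \<otimes> x31 (\<zeta> * b) =
      x31 (\<zeta> * b) \<otimes> x32 (\<zeta> * a * (\<zeta> * b)) \<otimes> x12 (\<zeta> * a)"
    by (simp only:)
qed simp_all

text \<open>The transposition of the last two coordinates. With \<open>j\<close> it forms the pair
  of simple reflections for the upper triangular group.\<close>

definition k where "k = j \<otimes> (t \<otimes> j)"

lemma k_closed [simp]: "k \<in> carrier G" and k_square [simp]: "k \<otimes> k = \<one>"
  by (simp_all add: k_def m_assoc)

lemma k_square_left [simp]: "x \<in> carrier G \<Longrightarrow> k \<otimes> (k \<otimes> x) = x"
  by (simp add: k_square[THEN assoc_left])

text \<open>The relations between the upper unitriangular root elements are the conjugates of the
  relations above under the Weyl group \<open>\<langle>j, t\<rangle>\<close>.\<close>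

lemma x13_x23_commute: "x13 a \<otimes> x23 b = x23 b \<otimes> x13 a"
  using arg_cong[OF x12_x32_commute[of a b], of "\<lambda>z. k \<otimes> z \<otimes> k"]
  by (simp add: root_defs k_def m_assoc)

lemma x12_x13_commute: "x12 a \<otimes> x13 b = x13 b \<otimes> x12 a"
  using arg_cong[OF x32_x31_commute[of a b], of "\<lambda>z. t \<otimes> z \<otimes> t"]
  by (simp add: root_defs m_assoc)

lemma x23_x12_commutator: "x23 a \<otimes> x12 b = x12 b \<otimes> x13 (a * b) \<otimes> x23 a"
  using arg_cong[OF x12_x31_commutator[of a b], of "\<lambda>z. t \<otimes> (j \<otimes> z \<otimes> j) \<otimes> t"]
  by (simp add: root_defs m_assoc)

section \<open>The simple reflections acting on root elements\<close>

lemma weyl_conj: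
  "k \<otimes> (x12 a \<otimes> k) = x13 a" "k \<otimes> (x13 a \<otimes> k) = x12 a" "k \<otimes> (x23 a \<otimes> k) = x32 a"
  "j \<otimes> (x13 a \<otimes> j) = x23 a" "j \<otimes> (x23 a \<otimes> j) = x13 a"
  by (simp_all add: root_defs k_def m_assoc)

lemma weyl_push: "k \<otimes> x12 a = x13 a \<otimes> k" "k \<otimes> x13 a = x12 a \<otimes> k" "k \<otimes> x23 a = x32 a \<otimes> k"
  "j \<otimes> x13 a = x23 a \<otimes> j" "j \<otimes> x23 a = x13 a \<otimes> j"
  by (simp_all add: m_assoc flip: weyl_conj(1,3,5)) (simp_all add: m_assoc flip: weyl_conj(2,4))

lemmas weyl_push_left = weyl_push[THEN assoc_left, simplified, simplified m_assoc, simplified]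

end

section \<open>The chain of subgroups\<close>

context M23_group
begin

section \<open>The Borel subgroup and its rank-one relations\<close>

definition torus where "torus = {\<one>, r, r'}"

lemma torus_subgroup: "subgroup torus G"
  by (rule subgroupI) (auto simp: torus_def)

lemma torus_closed [simp]: "h \<in> torus \<Longrightarrow> h \<in> carrier G"
  by (auto simp: torus_def)

lemma torus_conj: "h \<in> torus \<Longrightarrow> j \<otimes> (h \<otimes> j) \<in> torus" "h \<in> torus \<Longrightarrow> k \<otimes> (h \<otimes> k) \<in> torus"
  by (auto simp: torus_def k_def m_assoc)

lemma subgroup_range_hom:
  assumes "\<And>a. f a \<in> carrier G" "\<And>a b. f a \<otimes> f b = f (a + b)" "f (0 :: 'k) = \<one>"
  shows "subgroup (range f) G"
proof (rule subgroupI)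
  have "inv (f a) = f (- a)" for a
    using assms by (intro inv_equality) simp_all
  then show "\<And>x. x \<in> range f \<Longrightarrow> inv x \<in> range f" by auto
qed (use assms in auto)

text \<open>The group \<open>U\<close> of the overview, written by its normal form.\<close>

definition borel where "borel = range x12 <#> range x13 <#> range x23 <#> torus"

lemma borelE:
  assumes "g \<in> borel"
  obtains a b c h where "g = x12 a \<otimes> x13 b \<otimes> x23 c \<otimes> h" "h \<in> torus"
  using assms by (auto simp: borel_def set_mult_def)

text \<open>Each new factor normalizes the product of the preceding ones: \<open>x13\<close>
  centralizes \<open>x12\<close>, conjugation by \<open>x23\<close> alters only the
  \<open>x13\<close> parameter, and the torus rescales all three.\<close>

lemma borel_subgroup: "subgroup borel G"
  unfolding borel_def
proof (intro subgroup_set_mult torus_subgroup)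
  show "subgroup (range x12) G" "subgroup (range x13) G" "subgroup (range x23) G"
    by (rule subgroup_range_hom; simp add: x12_add root_add)+
  fix g c assume "g \<in> range x12" "c \<in> range x13"
  then obtain a b where g: "g = x12 a" "c = x13 b" by auto
  then have "c \<otimes> g \<otimes> inv c = g" by (simp add: m_assoc flip: x12_x13_commute)
  with g show "c \<otimes> g \<otimes> inv c \<in> range x12" by simp
next
  fix g c assume "g \<in> range x12 <#> range x13" "c \<in> range x23"
  then obtain a b d where g: "g = x12 a \<otimes> x13 b" "c = x23 d" by (auto simp: set_mult_def)
  have "c \<otimes> g = x12 a \<otimes> x13 (d * a + b) \<otimes> c"
    by (simp add: g m_assoc x23_x12_commutator[THEN assoc_left] root_add_left
        flip: x13_x23_commute)
  then have "c \<otimes> g \<otimes> inv c = x12 a \<otimes> x13 (d * a + b)" by (simp add: g m_assoc)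
  then show "c \<otimes> g \<otimes> inv c \<in> range x12 <#> range x13" by (auto simp: set_mult_def)
next
  fix g c assume "g \<in> range x12 <#> range x13 <#> range x23" "c \<in> torus"
  then obtain a b d where g: "g = x12 a \<otimes> x13 b \<otimes> x23 d" and c: "c \<in> torus"
    by (auto simp: set_mult_def)
  have "\<exists>a' b' d'. c \<otimes> g = x12 a' \<otimes> x13 b' \<otimes> x23 d' \<otimes> c"
    using c unfolding torus_def
  proof (elim insertE emptyE)
    assume "c = \<one>" then show ?thesis by (auto simp: g)
  next
    assume "c = r" then have "c \<otimes> g = x12 (\<zeta> * a) \<otimes> x13 ((\<zeta> + 1) * b) \<otimes> x23 (\<zeta> * d) \<otimes> c"
      by (simp add: g m_assoc x12_conj_r_left root_conj_r_left root_conj_r)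
    then show ?thesis by blast
  next
    assume "c = r'" then have "c \<otimes> g = x12 ((\<zeta> + 1) * a) \<otimes> x13 (\<zeta> * b) \<otimes> x23 ((\<zeta> + 1) * d) \<otimes> c"
      by (simp add: g m_assoc x12_conj_r_left root_conj_r_left root_conj_r)
    then show ?thesis by blast
  qed
  then obtain a' b' d' where "c \<otimes> g = x12 a' \<otimes> x13 b' \<otimes> x23 d' \<otimes> c" by blast
  then have "c \<otimes> g \<otimes> inv c = x12 a' \<otimes> x13 b' \<otimes> x23 d'" using c by (simp add: m_assoc)
  then show "c \<otimes> g \<otimes> inv c \<in> range x12 <#> range x13 <#> range x23" by (auto simp: set_mult_def)
qed

lemma borelI: "h \<in> torus \<Longrightarrow> x12 a \<otimes> x13 b \<otimes> x23 c \<otimes> h \<in> borel"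
  by (auto simp: borel_def set_mult_def)

lemma borel_mem [simp]: "x12 a \<in> borel" "x13 a \<in> borel" "x23 a \<in> borel"
  and torus_borel: "h \<in> torus \<Longrightarrow> h \<in> borel"
  using borelI[of \<one> a 0 0] borelI[of \<one> 0 a 0] borelI[of \<one> 0 0 a] borelI[of h 0 0 0]
  by (simp_all add: torus_def)

lemmas borel_closed [simp] = subgroup.mem_carrier[OF borel_subgroup]

text \<open>The Bruhat relation of rank one. The case \<open>a = 1\<close> is
  \<open>(j s)^3 = 1\<close>; conjugation by \<open>r\<close> and \<open>r'\<close>, which
  \<open>j\<close> inverts, gives the other two parameters.\<close>

lemma j_x12_j:
  assumes "a \<noteq> 0"
  obtains b h where "h \<in> torus" "j \<otimes> (x12 a \<otimes> j) = x12 b \<otimes> (j \<otimes> (h \<otimes> x12 b))"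
proof -
  have a: "a = 1 \<or> a = \<zeta> \<or> a = \<zeta> + 1" using assms field_cases[of a] by simp
  have "j \<otimes> (x12 1 \<otimes> j) = x12 1 \<otimes> (j \<otimes> (\<one> \<otimes> x12 1))" by (simp add: j_x12_one)
  moreover have "j \<otimes> (x12 \<zeta> \<otimes> j) = r' \<otimes> ((j \<otimes> (x12 1 \<otimes> j)) \<otimes> r)"
    "j \<otimes> (x12 (\<zeta> + 1) \<otimes> j) = r \<otimes> ((j \<otimes> (x12 1 \<otimes> j)) \<otimes> r')"
    by (simp_all add: m_assoc x12_conj_r_left gf4_simps)
  ultimately have "j \<otimes> (x12 \<zeta> \<otimes> j) = x12 (\<zeta> + 1) \<otimes> (j \<otimes> (r' \<otimes> x12 (\<zeta> + 1)))"
    "j \<otimes> (x12 (\<zeta> + 1) \<otimes> j) = x12 \<zeta> \<otimes> (j \<otimes> (r \<otimes> x12 \<zeta>))"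
    by (simp_all add: j_x12_one m_assoc x12_conj_r x12_conj_r_left gf4_simps)
  with a that[of \<one> 1] that[of r' "\<zeta> + 1"] that[of r \<zeta>] show thesis
    by (auto simp: torus_def j_x12_one)
qed

text \<open>Conjugation by \<open>t j\<close> carries \<open>j\<close> to \<open>k\<close> and
  \<open>x12\<close> to \<open>x23\<close> and centralizes the torus, so it transports the preceding
  relation.\<close>

lemma k_x23_k:
  assumes "a \<noteq> 0"
  obtains b h where "h \<in> torus" "k \<otimes> (x23 a \<otimes> k) = x23 b \<otimes> (k \<otimes> (h \<otimes> x23 b))"
proof -
  from assms obtain b h where h: "h \<in> torus" and
    eq: "j \<otimes> (x12 a \<otimes> j) = x12 b \<otimes> (j \<otimes> (h \<otimes> x12 b))" by (rule j_x12_j)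
  have "k \<otimes> (x23 a \<otimes> k) = t \<otimes> (j \<otimes> ((j \<otimes> (x12 a \<otimes> j)) \<otimes> (j \<otimes> t)))"
    by (simp add: k_def x23_def m_assoc)
  also have "\<dots> = x23 b \<otimes> (k \<otimes> (h \<otimes> x23 b))"
    using h by (auto simp: eq k_def x23_def m_assoc torus_def)
  finally show thesis using h that by blast
qed

text \<open>These are \<open>B\<close>, \<open>H\<close> and \<open>K\<close> of the overview. Their
  images fix \<open>[1,0,0]\<close>, both new points, and \<open>New_v\<close>,
  respectively.\<close>

definition point_stab where "point_stab = double_coset_union G borel k"
definition psl_part where "psl_part = double_coset_union G point_stab j"
definition m22_part where "m22_part = double_coset_union G psl_part u"

text \<open>Conjugation by \<open>k\<close> interchanges \<open>x12\<close> and \<open>x13\<close>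
  and normalizes the torus, so only the factor \<open>x23 d\<close> can leave \<open>borel\<close>;
  \<open>k_x23_k\<close> deals with it.\<close>

lemma point_stab_subgroup: "subgroup point_stab G"
  unfolding point_stab_def
proof (rule subgroup_double_coset_union[OF borel_subgroup])
  fix b assume "b \<in> borel"
  then obtain a c d h where b: "b = x12 a \<otimes> x13 c \<otimes> x23 d \<otimes> h" and h: "h \<in> torus"
    by (rule borelE)
  have D: "k \<otimes> (x23 d \<otimes> k) \<in> double_coset_union G borel k"
  proof (cases "d = 0")
    case True
    then show ?thesis by (simp add: double_coset_unionI subgroup.one_closed[OF borel_subgroup])
  next
    case False
    then obtain e h where h: "h \<in> torus" and
      eq: "k \<otimes> (x23 d \<otimes> k) = x23 e \<otimes> (k \<otimes> (h \<otimes> x23 e))" by (rule k_x23_k)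
    have "h \<otimes> x23 e \<in> borel"
      using h borel_subgroup by (simp add: subgroup.m_closed torus_borel)
    from double_coset_unionI(2)[OF _ this, of "x23 e" G k]
    show ?thesis using h by (simp add: eq m_assoc)
  qed
  have "x13 a \<otimes> x12 c \<in> borel"
    using borel_subgroup by (simp add: subgroup.m_closed)
  moreover have "k \<otimes> (h \<otimes> k) \<in> borel" using h by (simp add: torus_conj torus_borel)
  ultimately have "(x13 a \<otimes> x12 c) \<otimes> (k \<otimes> (x23 d \<otimes> k)) \<otimes> (k \<otimes> (h \<otimes> k)) \<in> double_coset_union G borel k"
    by (intro double_coset_union_mult(2)[OF borel_subgroup k_closed _
       double_coset_union_mult(1)[OF borel_subgroup k_closed _ D]])
  also have "(x13 a \<otimes> x12 c) \<otimes> (k \<otimes> (x23 d \<otimes> k)) \<otimes> (k \<otimes> (h \<otimes> k)) = k \<otimes> b \<otimes> k"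
    using h by (simp add: b m_assoc weyl_push_left)
  finally show "k \<otimes> b \<otimes> k \<in> double_coset_union G borel k" .
qed simp_all

lemmas point_stab_closed [simp] = subgroup.mem_carrier[OF point_stab_subgroup]
lemmas point_stab_mult = subgroup.m_closed[OF point_stab_subgroup]

lemma borel_point_stab: "b \<in> borel \<Longrightarrow> b \<in> point_stab"
  by (simp add: point_stab_def double_coset_unionI)

lemma k_point_stab: "k \<in> point_stab"
  using double_coset_unionI(2)[of \<one> borel \<one> G k] subgroup.one_closed[OF borel_subgroup]
  by (simp add: point_stab_def)

text \<open>Moving the two root elements across yields the one place where \<open>j k j = k j k\<close> is needed to
  multiply double cosets.\<close>

lemma j_k_j:
  "j \<otimes> (x12 a \<otimes> (k \<otimes> (x12 b \<otimes> j))) = x23 b \<otimes> (k \<otimes> (j \<otimes> (k \<otimes> x23 a)))"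
proof -
  have "j \<otimes> (x12 a \<otimes> (k \<otimes> (x12 b \<otimes> j))) = j \<otimes> ((x12 a \<otimes> x13 b) \<otimes> (k \<otimes> j))"
    by (simp add: m_assoc flip: weyl_conj(1))
  also have "\<dots> = (j \<otimes> (x13 b \<otimes> j)) \<otimes> (j \<otimes> (k \<otimes> (j \<otimes> (j \<otimes> ((k \<otimes> (x12 a \<otimes> k)) \<otimes> j)))))"
    unfolding x12_x13_commute by (simp add: m_assoc)
  also have "\<dots> = x23 b \<otimes> ((j \<otimes> (k \<otimes> j)) \<otimes> x23 a)"
    unfolding weyl_conj by (simp add: m_assoc)
  also have "j \<otimes> (k \<otimes> j) = k \<otimes> (j \<otimes> k)" by (simp add: k_def m_assoc)
  finally show ?thesis by (simp add: m_assoc)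
qed

lemma psl_part_subgroup: "subgroup psl_part G"
  unfolding psl_part_def
proof (rule subgroup_double_coset_union[OF point_stab_subgroup])
  let ?D = "double_coset_union G point_stab j"
  note S = point_stab_subgroup gens_closed(2)
  have wrap: "g \<otimes> d \<otimes> g' \<in> ?D" if "d \<in> ?D" "g \<in> point_stab" "g' \<in> point_stab" for d g g'
    by (rule double_coset_union_mult(2)[OF S that(3) double_coset_union_mult(1)[OF S that(2,1)]])
  fix b assume "b \<in> point_stab"
  then have "b \<in> double_coset_union G borel k" by (simp add: point_stab_def)
  then show "j \<otimes> b \<otimes> j \<in> ?D"
  proof (cases rule: double_coset_unionE)
    case 1
    then obtain a c d h where b: "b = x12 a \<otimes> x13 c \<otimes> x23 d \<otimes> h" and h: "h \<in> torus"
      by (rule borelE)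
    \<comment> \<open>Since \<open>j\<close> interchanges \<open>x13\<close> and \<open>x23\<close>
      and normalizes the torus, only the factor \<open>x12 a\<close> can leave
      \<open>point_stab\<close>.\<close>
    have D: "j \<otimes> (x12 a \<otimes> j) \<in> ?D"
    proof (cases "a = 0")
      case True
      then show ?thesis by (simp add: double_coset_unionI subgroup.one_closed[OF point_stab_subgroup])
    next
      case False
      then obtain e h where h: "h \<in> torus" and
        eq: "j \<otimes> (x12 a \<otimes> j) = x12 e \<otimes> (j \<otimes> (h \<otimes> x12 e))" by (rule j_x12_j)
      have "h \<otimes> x12 e \<in> point_stab"
        using h by (simp add: point_stab_mult borel_point_stab torus_borel)
      from double_coset_unionI(2)[OF _ this, of "x12 e" G j]
      show ?thesis using h by (simp add: eq m_assoc borel_point_stab)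
    qed
    have "x23 c \<otimes> (x13 d \<otimes> (j \<otimes> (h \<otimes> j))) \<in> point_stab"
      using h by (simp add: point_stab_mult borel_point_stab torus_borel torus_conj)
    from wrap[OF D subgroup.one_closed[OF point_stab_subgroup] this]
    show ?thesis using h by (simp add: b m_assoc weyl_push_left)
  next
    case (2 b1 b2)
    \<comment> \<open>Decomposing \<open>inv b1\<close> instead of \<open>b1\<close> puts the
      \<open>x12\<close> factor of \<open>b1\<close> last, next to \<open>k\<close>. The outer
      factors then pass across \<open>j\<close> into \<open>point_stab\<close>, which leaves exactly
      the word treated in \<open>j_k_j\<close>.\<close>
    from borelE[OF subgroup.m_inv_closed[OF borel_subgroup 2(1)]]
    obtain a c d h where b1: "inv b1 = x12 a \<otimes> x13 c \<otimes> x23 d \<otimes> h" and h: "h \<in> torus" .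
    from borelE[OF 2(2)] obtain a' c' d' h' where
      b2: "b2 = x12 a' \<otimes> x13 c' \<otimes> x23 d' \<otimes> h'" and h': "h' \<in> torus" .
    have self: "inv (f e) = f e" if "f \<in> {x12, x13, x23}" for f e
      using that by (auto intro!: inv_equality simp: x12_add root_add add_self)
    have "b1 = inv (inv b1)" using 2 by simp
    also have "\<dots> = inv h \<otimes> (x23 d \<otimes> (x13 c \<otimes> x12 a))"
      unfolding b1 using h by (simp add: inv_mult_group self m_assoc)
    finally have b1': "b1 = inv h \<otimes> (x23 d \<otimes> (x13 c \<otimes> x12 a))" .
    have ih: "inv h \<in> torus" using h torus_subgroup by (simp add: subgroup.m_inv_closed)
    have "j \<otimes> b \<otimes> j = ((j \<otimes> (inv h \<otimes> j)) \<otimes> (x13 d \<otimes> x23 c)) \<otimes>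
        (j \<otimes> (x12 a \<otimes> (k \<otimes> (x12 a' \<otimes> j)))) \<otimes>
        (x23 c' \<otimes> (x13 d' \<otimes> (j \<otimes> (h' \<otimes> j))))"
      using h h' by (simp add: 2(3) b1' b2 m_assoc weyl_push_left)
    moreover have "(x23 a' \<otimes> k) \<otimes> j \<otimes> (k \<otimes> x23 a) \<in> ?D"
      by (intro double_coset_unionI) (simp_all add: point_stab_mult borel_point_stab k_point_stab)
    then have "j \<otimes> (x12 a \<otimes> (k \<otimes> (x12 a' \<otimes> j))) \<in> ?D" by (simp add: j_k_j m_assoc)
    then have "((j \<otimes> (inv h \<otimes> j)) \<otimes> (x13 d \<otimes> x23 c)) \<otimes>
        (j \<otimes> (x12 a \<otimes> (k \<otimes> (x12 a' \<otimes> j)))) \<otimes>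
        (x23 c' \<otimes> (x13 d' \<otimes> (j \<otimes> (h' \<otimes> j)))) \<in> ?D"
      by (rule wrap) (use ih h' in \<open>simp_all add: point_stab_mult borel_point_stab torus_borel torus_conj\<close>)
    ultimately show ?thesis by simp
  qed
qed simp_all

lemmas psl_part_closed [simp] = subgroup.mem_carrier[OF psl_part_subgroup]
lemmas psl_part_mult = subgroup.m_closed[OF psl_part_subgroup]

lemma point_stab_psl_part: "b \<in> point_stab \<Longrightarrow> b \<in> psl_part"
  by (simp add: psl_part_def double_coset_unionI)

lemma j_psl_part: "j \<in> psl_part"
  using double_coset_unionI(2)[of \<one> point_stab \<one> G j] subgroup.one_closed[OF point_stab_subgroup]
  by (simp add: psl_part_def)

section \<open>Conjugation by \<open>u\<close> and \<open>v\<close>, and the top of the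
  chain\<close>

lemma t_eq: "t = j \<otimes> (k \<otimes> j)"
  by (simp add: k_def m_assoc)

lemma x32_eq: "x32 a = k \<otimes> (x23 a \<otimes> k)"
  by (simp add: weyl_conj)

text \<open>Expresses \<open>k\<close> through root elements of parameter 1, whose conjugates under
  \<open>u\<close> and \<open>v\<close> are known.\<close>

lemma k_eq: "k = x23 1 \<otimes> (x32 1 \<otimes> x23 1)"
proof -
  have "x23 1 \<otimes> (x32 1 \<otimes> x23 1) = t \<otimes> (j \<otimes> (s \<otimes> ((j \<otimes> (s \<otimes> j)) \<otimes> (s \<otimes> (j \<otimes> t)))))"
    by (simp add: x23_def x32_def x12_one m_assoc)
  also have "\<dots> = k" by (simp add: relation_cubes(2) k_def m_assoc)
  finally show ?thesis ..
qed

lemma x13_eq: "x13 a = x12 a \<otimes> (x23 1 \<otimes> (x12 a \<otimes> x23 1))"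
  by (simp add: x23_x12_commutator m_assoc x12_add_left root_add add_self
      x12_x13_commute[THEN assoc_left] x23_x12_commutator[THEN assoc_left])

text \<open>The three elements generate \<open>borel\<close>: conjugation by \<open>r\<close> gives
  the other parameters, and \<open>x13\<close> arises from commutators by
  \<open>x13_eq\<close>.\<close>

lemma borel_subset:
  assumes M: "subgroup M G" and mem: "s \<in> M" "r \<in> M" "x23 1 \<in> M"
  shows "borel \<subseteq> M"
proof
  have [simp]: "x \<otimes> y \<in> M" if "x \<in> M" "y \<in> M" for x y
    using M that by (rule subgroup.m_closed)
  have [simp]: "\<one> \<in> M" "r' \<in> M"
    using M mem by (simp_all add: subgroup.one_closed subgroup.m_inv_closed)
  note [simp] = mem
  have 12 [simp]: "x12 a \<in> M" for a by (simp add: x12_def)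
  have "x23 \<zeta> = r \<otimes> (x23 1 \<otimes> r')" "x23 (\<zeta> + 1) = r' \<otimes> (x23 1 \<otimes> r)"
    by (simp_all add: root_conj_r_left m_assoc)
  then have 23 [simp]: "x23 a \<in> M" for a using field_cases[of a] by auto
  have 13 [simp]: "x13 a \<in> M" for a by (simp add: x13_eq)
  fix g assume "g \<in> borel"
  then show "g \<in> M" by (elim borelE) (auto simp: torus_def)
qed

lemma double_coset_union_subset:
  assumes "subgroup M G" "S \<subseteq> M" "x \<in> M"
  shows "double_coset_union G S x \<subseteq> M"
  using assms by (auto simp: double_coset_union_def intro!: subgroup.m_closed)

text \<open>By \<open>k_eq\<close> it suffices to conjugate \<open>s\<close>, \<open>r\<close>,
  \<open>x23 1\<close> and \<open>x32 1\<close>; \<open>u_roots\<close> gives the last two.\<close>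

lemma u_point_stab: "b \<in> point_stab \<Longrightarrow> u \<otimes> b \<otimes> u \<in> point_stab"
proof -
  let ?M = "{g \<in> carrier G. u \<otimes> g \<otimes> u \<in> point_stab}"
  note [simp] = point_stab_mult borel_point_stab k_point_stab
  have M: "subgroup ?M G"
    by (rule subgroup_conj_preimage[OF point_stab_subgroup]) simp_all
  have s: "s \<in> point_stab" by (metis borel_mem(1) borel_point_stab x12_one)
  have x32: "x32 a \<in> point_stab" for a by (simp add: x32_eq)
  have "u \<otimes> s \<otimes> u = s" by (simp add: relation_commute m_assoc)
  then have "s \<in> ?M" using s by simp
  \<comment> \<open>The relation says that \<open>u\<close> conjugates \<open>r\<close> as
    \<open>j\<close> does, and \<open>j\<close> inverts \<open>r\<close>.\<close>
  moreover have "u \<otimes> (r \<otimes> u) = r'"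
    using defining_relations(14) by (simp add: conj_by_def m_assoc)
  then have "r \<in> ?M" by (simp add: m_assoc torus_borel torus_def)
  moreover have "x23 1 \<in> ?M" by (simp add: m_assoc u_roots)
  ultimately have borel: "borel \<subseteq> ?M" by (intro borel_subset M)
  have "x32 1 \<in> ?M" using x32 by (simp add: m_assoc u_roots)
  with \<open>x23 1 \<in> ?M\<close> have "k \<in> ?M"
    unfolding k_eq by (intro subgroup.m_closed[OF M])
  from double_coset_union_subset[OF M borel this] have "point_stab \<subseteq> ?M"
    unfolding point_stab_def[symmetric] .
  then show "b \<in> point_stab \<Longrightarrow> u \<otimes> b \<otimes> u \<in> point_stab" by auto
qed

text \<open>The same test on generators, with \<open>v_roots\<close> for the root elements and
  \<open>j\<close> as an additional generator, which commutes with \<open>v\<close>.\<close>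

lemma v_psl_part: "b \<in> psl_part \<Longrightarrow> v \<otimes> b \<otimes> v \<in> psl_part"
proof -
  let ?M = "{g \<in> carrier G. v \<otimes> g \<otimes> v \<in> psl_part}"
  note [simp] = psl_part_mult point_stab_psl_part borel_point_stab k_point_stab j_psl_part
  have M: "subgroup ?M G"
    by (rule subgroup_conj_preimage[OF psl_part_subgroup]) simp_all
  have s: "s \<in> psl_part" by (metis borel_mem(1) borel_point_stab point_stab_psl_part x12_one)
  have x32: "x32 a \<in> psl_part" for a by (simp add: x32_eq)
  have "v \<otimes> s \<otimes> v = s" by (simp add: relation_commute m_assoc)
  then have "s \<in> ?M" using s by simp
  moreover have "v \<otimes> r \<otimes> v = r'" by (simp add: m_assoc)
  then have "r \<in> ?M" by (simp add: torus_borel torus_def)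
  moreover have x23: "x23 1 \<in> ?M" by (simp add: m_assoc v_roots)
  ultimately have borel: "borel \<subseteq> ?M" by (intro borel_subset M)
  have "x32 1 \<in> ?M" using x32 by (simp add: m_assoc v_roots)
  with x23 have "k \<in> ?M"
    unfolding k_eq by (intro subgroup.m_closed[OF M])
  from double_coset_union_subset[OF M borel this] have "point_stab \<subseteq> ?M"
    unfolding point_stab_def[symmetric] .
  moreover have "j \<in> ?M" by (simp add: relation_commute m_assoc)
  ultimately have "double_coset_union G point_stab j \<subseteq> ?M"
    by (intro double_coset_union_subset M)
  then have "psl_part \<subseteq> ?M" unfolding psl_part_def[symmetric] .
  then show "b \<in> psl_part \<Longrightarrow> v \<otimes> b \<otimes> v \<in> psl_part" by auto
qed

lemma m22_part_subgroup: "subgroup m22_part G"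
  unfolding m22_part_def
proof (rule subgroup_double_coset_union[OF psl_part_subgroup])
  fix b assume "b \<in> psl_part"
  then have "b \<in> double_coset_union G point_stab j" by (simp add: psl_part_def)
  then show "u \<otimes> b \<otimes> u \<in> double_coset_union G psl_part u"
  proof (cases rule: double_coset_unionE)
    case 1
    then show ?thesis by (intro double_coset_unionI point_stab_psl_part u_point_stab)
  next
    case (2 b1 b2)
    \<comment> \<open>Inserting \<open>u u = 1\<close> around \<open>j\<close> isolates
      \<open>u j u\<close>, which the braid relation replaces by \<open>j u j\<close>; the outer
      factors stay in \<open>point_stab\<close>.\<close>
    have "u \<otimes> b \<otimes> u = (u \<otimes> b1 \<otimes> u) \<otimes> (u \<otimes> (j \<otimes> u)) \<otimes> (u \<otimes> b2 \<otimes> u)"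
      using 2 by (simp add: m_assoc)
    also have "\<dots> = ((u \<otimes> b1 \<otimes> u) \<otimes> j) \<otimes> u \<otimes> (j \<otimes> (u \<otimes> b2 \<otimes> u))"
      using 2 by (simp only: relation_cubes(3)) (simp add: m_assoc)
    also have "\<dots> \<in> double_coset_union G psl_part u"
      using 2 by (intro double_coset_unionI psl_part_mult j_psl_part point_stab_psl_part u_point_stab)
    finally show ?thesis .
  qed
qed simp_all

lemmas m22_part_closed [simp] = subgroup.mem_carrier[OF m22_part_subgroup]
lemmas m22_part_mult = subgroup.m_closed[OF m22_part_subgroup]

lemma psl_part_m22_part: "b \<in> psl_part \<Longrightarrow> b \<in> m22_part"
  by (simp add: m22_part_def double_coset_unionI)

lemma u_m22_part: "u \<in> m22_part"
  using double_coset_unionI(2)[of \<one> psl_part \<one> G u] subgroup.one_closed[OF psl_part_subgroup]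
  by (simp add: m22_part_def)

text \<open>The union is a subgroup because \<open>v\<close> normalizes \<open>psl_part\<close> and
  braids with \<open>u\<close>; it contains all six generators.\<close>

lemma carrier_eq: "carrier G = double_coset_union G m22_part v"
proof -
  let ?D = "double_coset_union G m22_part v"
  have D: "subgroup ?D G"
  proof (rule subgroup_double_coset_union[OF m22_part_subgroup])
    fix b assume "b \<in> m22_part"
    then have "b \<in> double_coset_union G psl_part u" by (simp add: m22_part_def)
    then show "v \<otimes> b \<otimes> v \<in> double_coset_union G m22_part v"
    proof (cases rule: double_coset_unionE)
      case 1
      then show ?thesis by (intro double_coset_unionI psl_part_m22_part v_psl_part)
    next
      case (2 b1 b2)
      have "v \<otimes> b \<otimes> v = (v \<otimes> b1 \<otimes> v) \<otimes> (v \<otimes> (u \<otimes> v)) \<otimes> (v \<otimes> b2 \<otimes> v)"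
        using 2 by (simp add: m_assoc)
      also have "\<dots> = ((v \<otimes> b1 \<otimes> v) \<otimes> u) \<otimes> v \<otimes> (u \<otimes> (v \<otimes> b2 \<otimes> v))"
        using 2 by (simp only: relation_cubes(4)) (simp add: m_assoc)
      also have "\<dots> \<in> double_coset_union G m22_part v"
        using 2 by (intro double_coset_unionI m22_part_mult u_m22_part psl_part_m22_part v_psl_part)
      finally show ?thesis .
    qed
  qed simp_all
  have one: "\<one> \<in> m22_part" by (rule subgroup.one_closed[OF m22_part_subgroup])
  have borel: "b \<in> psl_part" if "b \<in> borel" for b
    using that by (intro point_stab_psl_part borel_point_stab)
  have "s \<in> psl_part" using borel[OF borel_mem(1)[of 1]] by (simp add: x12_one)
  moreover have "r \<in> psl_part" by (intro borel torus_borel) (simp add: torus_def)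
  moreover have "j \<otimes> (k \<otimes> j) \<in> psl_part"
    by (intro psl_part_mult j_psl_part point_stab_psl_part k_point_stab)
  then have "t \<in> psl_part" by (simp only: t_eq[symmetric])
  ultimately have "{s, j, t, r, u, v} \<subseteq> ?D"
    using double_coset_unionI(2)[OF one one, of G v]
    by (auto intro!: double_coset_unionI(1) psl_part_m22_part u_m22_part j_psl_part)
  then have "generate G {s, j, t, r, u, v} \<subseteq> ?D" by (rule generate_subgroup_incl[OF _ D])
  then show ?thesis using generated subgroup.subset[OF D] by auto
qed

end

section \<open>The permutations satisfy the relations\<close>

lemma carrier_BijGroup_UNIV: "carrier (BijGroup UNIV) = {f. bij f}"
  by (auto simp: BijGroup_def Bij_def)

lemma one_BijGroup_UNIV: "\<one>\<^bsub>BijGroup UNIV\<^esub> = id"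
  by (auto simp: BijGroup_def)

lemma mult_BijGroup_UNIV: "bij f \<Longrightarrow> bij g \<Longrightarrow> f \<otimes>\<^bsub>BijGroup UNIV\<^esub> g = f \<circ> g"
  by (auto simp: BijGroup_def Bij_def compose_def)

lemma inv_BijGroup_UNIV:
  assumes "f \<circ> g = id" "g \<circ> f = id"
  shows "inv\<^bsub>BijGroup UNIV\<^esub> f = g"
proof -
  interpret group "BijGroup UNIV" by (rule group_BijGroup)
  have "bij f" "bij g" using assms o_bij by blast+
  with assms show ?thesis
    by (intro inv_equality) (simp_all add: carrier_BijGroup_UNIV mult_BijGroup_UNIV one_BijGroup_UNIV)
qed

lemma pow_BijGroup_UNIV:
  assumes "bij f"
  shows "f [^]\<^bsub>BijGroup UNIV\<^esub> (2::nat) = f \<circ> f" "f [^]\<^bsub>BijGroup UNIV\<^esub> (3::nat) = f \<circ> f \<circ> f"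
proof -
  interpret group "BijGroup UNIV" by (rule group_BijGroup)
  show "f [^]\<^bsub>BijGroup UNIV\<^esub> (2::nat) = f \<circ> f" "f [^]\<^bsub>BijGroup UNIV\<^esub> (3::nat) = f \<circ> f \<circ> f"
    using assms
    by (simp_all add: numeral_2_eq_2 numeral_3_eq_3 mult_BijGroup_UNIV one_BijGroup_UNIV bij_comp)
qed

section \<open>Coordinates of points and the action of matrices\<close>

lemma pt_cases:
  obtains x y z where "p = pt x y z" "\<not> (x = 0 \<and> y = 0 \<and> z = 0)"
proof (induction p rule: proj_plane.abs_induct)
  case (1 w)
  then have "w \<noteq> 0" by (simp add: proportional_refl_iff)
  moreover have "w = vector [w $ 1, w $ 2, w $ 3]" by (simp add: vec_eq_iff forall_3)
  ultimately show ?case using 1(2) unfolding pt_def by (metis vector_3_eq_0_iff)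
qed

lemma pt_scale:
  assumes "c \<noteq> 0" "\<not> (x = 0 \<and> y = 0 \<and> z = 0)"
  shows "pt (c * x) (c * y) (c * z) = pt x y z"
  using assms by (subst eq_commute, subst pt_eq_iff) auto

lemma mat_act_pt:
  fixes A :: "'k::field ^ 3 ^ 3"
  assumes "\<not> (x = 0 \<and> y = 0 \<and> z = 0)" "det A \<noteq> 0"
  shows "mat_act A (pt x y z) = pt (A $ 1 $ 1 * x + A $ 1 $ 2 * y + A $ 1 $ 3 * z)
     (A $ 2 $ 1 * x + A $ 2 $ 2 * y + A $ 2 $ 3 * z)
     (A $ 3 $ 1 * x + A $ 3 $ 2 * y + A $ 3 $ 3 * z)"
proof -
  have "A *v vector [x, y, z] = vector [A $ 1 $ 1 * x + A $ 1 $ 2 * y + A $ 1 $ 3 * z,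
     A $ 2 $ 1 * x + A $ 2 $ 2 * y + A $ 2 $ 3 * z, A $ 3 $ 1 * x + A $ 3 $ 2 * y + A $ 3 $ 3 * z]"
    by (simp add: vec_eq_iff forall_3 matrix_vector_mult_def sum_3)
  with assms show ?thesis
    by (simp add: pt_def mat_act.abs_eq proportional_refl_iff vector_3_eq_0_iff invertible_det_nz)
qed

lemma mat_perm_mult:
  fixes A B :: "'k::field ^ 3 ^ 3"
  assumes "det A \<noteq> 0" "det B \<noteq> 0"
  shows "mat_perm A \<circ> mat_perm B = mat_perm (A ** B)"
proof
  fix x :: "'k omega"
  have "mat_act A (mat_act B p) = mat_act (A ** B) p" for p :: "'k proj_plane"
  proof (induction p rule: proj_plane.abs_induct)
    case (1 w)
    then have "B *v w \<noteq> 0"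
      using assms(2) by (metis invertible_det_nz invertible_eq_bij bij_is_inj proportional_refl_iff
          matrix_vector_mult_0_right injD)
    with 1 assms show ?case
      by (simp add: mat_act.abs_eq proportional_refl_iff invertible_det_nz det_mul
          matrix_vector_mul_assoc)
  qed
  then show "(mat_perm A \<circ> mat_perm B) x = mat_perm (A ** B) x" by (cases x) simp_all
qed

lemma PSL3_perms_comp:
  "f \<in> PSL3_perms \<Longrightarrow> g \<in> PSL3_perms \<Longrightarrow> f \<circ> g \<in> PSL3_perms"
  by (auto simp: PSL3_perms_def mat_perm_mult) (metis det_mul mult_1)

text \<open>The matrices of \<open>j\<close> and \<open>t\<close> have determinant
  \<open>-1\<close>, hence the hypothesis of characteristic two.\<close>

lemma linear_perms_PSL3:
  assumes "z \<noteq> (0 :: 'k::field)" "(-1 :: 'k) = 1"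
  shows "(s_perm :: 'k omega \<Rightarrow> _) \<in> PSL3_perms" "(j_perm :: 'k omega \<Rightarrow> _) \<in> PSL3_perms"
    "(t_perm :: 'k omega \<Rightarrow> _) \<in> PSL3_perms" "r_perm z \<in> PSL3_perms"
  unfolding s_perm_def j_perm_def t_perm_def r_perm_def PSL3_perms_def
  using assms by (auto intro!: exI[of _ "vector [_, _, _]"] simp: det_3)

context gf4
begin

text \<open>An opaque name for the fourth element lets the simplifier compute with the table below, without
  associativity and commutativity.\<close>

definition \<omega> where "\<omega> = \<zeta> + 1"

section \<open>The generators evaluated on normalized points\<close>

lemma det_gens:
  "det (vector [vector [1, 1, 0], vector [0, 1, 0], vector [0, 0, 1]] :: 'k ^ 3 ^ 3) = 1"
  "det (vector [vector [0, 1, 0], vector [1, 0, 0], vector [0, 0, 1]] :: 'k ^ 3 ^ 3) = 1"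
  "det (vector [vector [0, 0, 1], vector [0, 1, 0], vector [1, 0, 0]] :: 'k ^ 3 ^ 3) = 1"
  "det (vector [vector [\<zeta>, 0, 0], vector [0, 1, 0], vector [0, 0, inverse \<zeta>]] :: 'k ^ 3 ^ 3) = 1"
  "det (vector [vector [\<zeta>, 0, 0], vector [0, 1, 0], vector [0, 0, \<omega>]] :: 'k ^ 3 ^ 3) = 1"
  by (simp_all add: det_3 \<omega>_def gf4_simps)

lemma gens_pt:
  assumes "\<not> (x = 0 \<and> y = 0 \<and> z = (0 :: 'k))"
  shows "s_perm (Pt (pt x y z)) = Pt (pt (x + y) y z)"
    "j_perm (Pt (pt x y z)) = Pt (pt y x z)"
    "t_perm (Pt (pt x y z)) = Pt (pt z y x)"
    "r_perm \<zeta> (Pt (pt x y z)) = Pt (pt (\<zeta> * x) y (\<omega> * z))"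
    "v_perm \<zeta> (Pt (pt x y z)) = Pt (pt (x\<^sup>2) (y\<^sup>2) (\<zeta> * z\<^sup>2))"
  using assms
  by (simp_all add: s_perm_def j_perm_def t_perm_def r_perm_def mat_act_pt det_gens v_map_pt
      inverse_zeta flip: \<omega>_def)

lemma gens_new:
  "s_perm New_u = New_u" "j_perm New_u = New_u" "t_perm New_u = New_u" "r_perm \<zeta> New_u = New_u"
  "s_perm New_v = New_v" "j_perm New_v = New_v" "t_perm New_v = New_v" "r_perm \<zeta> New_v = New_v"
  by (simp_all add: s_perm_def j_perm_def t_perm_def r_perm_def)

lemma two_eq_zero: "(2 :: 'k) = 0"
  using add_self[of 1] by (simp only: one_add_one)

lemma field_table:
  "1 + 1 = (0 :: 'k)" "(2 :: 'k) = 0" "1 + \<zeta> = \<omega>" "1 + \<omega> = \<zeta>" "\<zeta> + 1 = \<omega>" "\<zeta> + \<zeta> = 0" "\<zeta> + \<omega> = 1"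
  "\<omega> + 1 = \<zeta>" "\<omega> + \<zeta> = 1" "\<omega> + \<omega> = 0" "\<zeta> * \<zeta> = \<omega>" "\<zeta> * \<omega> = 1" "\<omega> * \<zeta> = 1" "\<omega> * \<omega> = \<zeta>"
  "\<zeta>\<^sup>2 = \<omega>" "\<omega>\<^sup>2 = \<zeta>" "\<zeta> ^ 4 = \<zeta>" "\<omega> ^ 4 = \<omega>" "\<omega> \<noteq> 0" "\<omega> \<noteq> 1" "\<zeta> \<noteq> \<omega>"
  unfolding \<omega>_def by (simp_all add: gf4_simps two_eq_zero power4_eq_xxxx)

lemma field_table_left:
  "\<zeta> * (\<zeta> * x) = \<omega> * x" "\<zeta> * (\<omega> * x) = x" "\<omega> * (\<zeta> * x) = x" "\<omega> * (\<omega> * x) = \<zeta> * x"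
  by (simp_all add: field_table flip: mult.assoc)

lemma field_UNIV: "(UNIV :: 'k set) = {0, 1, \<zeta>, \<omega>}"
  using field_cases by (auto simp: \<omega>_def)

text \<open>Makes the first nonzero coordinate 1, after which \<open>pt_neq\<close> decides equality
  of points coordinatewise.\<close>

lemma pt_normalize:
  "pt \<zeta> y z = pt 1 (\<omega> * y) (\<omega> * z)" "pt \<omega> y z = pt 1 (\<zeta> * y) (\<zeta> * z)"
  "pt 0 \<zeta> z = pt 0 1 (\<omega> * z)" "pt 0 \<omega> z = pt 0 1 (\<zeta> * z)"
  "pt 0 0 \<zeta> = pt 0 0 1" "pt 0 0 \<omega> = pt 0 0 1"
  using pt_scale[of \<omega> \<zeta> y z] pt_scale[of \<zeta> \<omega> y z] pt_scale[of \<omega> 0 \<zeta> z] pt_scale[of \<zeta> 0 \<omega> z]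
    pt_scale[of \<omega> 0 0 \<zeta>] pt_scale[of \<zeta> 0 0 \<omega>]
  by (simp_all add: field_table)

lemma pt_neq:
  "pt 1 a b = pt 1 c d \<longleftrightarrow> a = c \<and> b = (d :: 'k)" "pt 0 1 a \<noteq> pt 1 c (d :: 'k)" "pt 0 0 1 \<noteq> pt 1 c (d :: 'k)"
  by (auto simp: pt_eq_iff)

lemma gens_table:
  "s_perm (Pt (pt 1 a b)) = Pt (pt (1 + a) a b)" "s_perm (Pt (pt 0 1 a)) = Pt (pt 1 1 a)"
  "s_perm (Pt (pt 0 0 1)) = Pt (pt 0 0 (1 :: 'k))"
  "j_perm (Pt (pt 1 a b)) = Pt (pt a 1 b)" "j_perm (Pt (pt 0 1 a)) = Pt (pt 1 0 a)"
  "j_perm (Pt (pt 0 0 1)) = Pt (pt 0 0 (1 :: 'k))"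
  "t_perm (Pt (pt 1 a b)) = Pt (pt b a 1)" "t_perm (Pt (pt 0 1 a)) = Pt (pt a 1 0)"
  "t_perm (Pt (pt 0 0 1)) = Pt (pt 1 0 (0 :: 'k))"
  "r_perm \<zeta> (Pt (pt 1 a b)) = Pt (pt 1 (\<omega> * a) (\<zeta> * b))" "r_perm \<zeta> (Pt (pt 0 1 a)) = Pt (pt 0 1 (\<omega> * a))"
  "r_perm \<zeta> (Pt (pt 0 0 1)) = Pt (pt 0 0 1)"
  "u_perm (Pt (pt 1 a b)) = (if a = 0 \<and> b = 0 then New_u else Pt (pt (1 + a * b) (a\<^sup>2) (b\<^sup>2)))"
  "u_perm (Pt (pt 0 1 a)) = Pt (pt a 1 (a\<^sup>2))"
  "u_perm (Pt (pt 0 0 1)) = Pt (pt 0 0 (1 :: 'k))"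
  "v_perm \<zeta> (Pt (pt 1 a b)) = Pt (pt 1 (a\<^sup>2) (\<zeta> * b\<^sup>2))"
  "v_perm \<zeta> (Pt (pt 0 1 a)) = Pt (pt 0 1 (\<zeta> * a\<^sup>2))"
  "v_perm \<zeta> (Pt (pt 0 0 1)) = Pt (pt 0 0 1)"
  by (simp_all add: gens_pt del: u_perm.simps v_perm.simps)
    (auto simp: u_map_pt pt_neq pt_normalize field_table simp flip: mult.assoc)

declare u_perm.simps(1) [simp del] v_perm.simps(1) [simp del]

lemma omega_cases:
  obtains "x = New_u" | "x = New_v" | a b where "x = Pt (pt 1 a (b :: 'k))" | a where "x = Pt (pt 0 1 a)"
    | "x = Pt (pt 0 0 1)"
proof (cases x)
  case (Pt p)
  obtain a b c where p: "p = pt a b c" and nz: "\<not> (a = 0 \<and> b = 0 \<and> c = 0)" by (rule pt_cases)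
  show thesis
  proof (cases "a = 0")
    case False
    then show thesis using that(3)[of "inverse a * b" "inverse a * c"] pt_scale[of "inverse a" a b c]
      by (simp add: Pt p)
  next
    case a: True
    show thesis
    proof (cases "b = 0")
      case False
      then show thesis using a that(4)[of "inverse b * c"] pt_scale[of "inverse b" a b c]
        by (simp add: Pt p)
    next
      case True
      then show thesis using a nz that(5) pt_scale[of "inverse c" a b c] by (simp add: Pt p)
    qed
  qed
qed (use that in blast)+

text \<open>Reduces an equation to 23 evaluations: \<open>16 + 4 + 1\<close> normalized points and
  the two new ones.\<close>

lemma perm_eqI:
  fixes f :: "'k omega \<Rightarrow> 'c"
  assumes "\<forall>a \<in> {0, 1, \<zeta>, \<omega>}. \<forall>b \<in> {0, 1, \<zeta>, \<omega>}. f (Pt (pt 1 a b)) = g (Pt (pt 1 a b))"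
    "\<forall>a \<in> {0, 1, \<zeta>, \<omega>}. f (Pt (pt 0 1 a)) = g (Pt (pt 0 1 a))"
    "f (Pt (pt 0 0 1)) = g (Pt (pt 0 0 1))" "f New_u = g New_u" "f New_v = g New_v"
  shows "f = g"
proof
  fix x show "f x = g x"
    using assms by (cases x rule: omega_cases) (simp_all flip: field_UNIV)
qed

lemmas perm_simps = gens_table gens_new pt_normalize pt_neq field_table

lemma gens_square:
  "s_perm \<circ> s_perm = (id :: 'k omega \<Rightarrow> _)" "j_perm \<circ> j_perm = (id :: 'k omega \<Rightarrow> _)"
  "t_perm \<circ> t_perm = (id :: 'k omega \<Rightarrow> _)" "u_perm \<circ> u_perm = (id :: 'k omega \<Rightarrow> _)"
  "v_perm \<zeta> \<circ> v_perm \<zeta> = id" "r_perm \<zeta> \<circ> r_perm \<zeta> \<circ> r_perm \<zeta> = id"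
  by (rule perm_eqI; simp add: perm_simps)+

lemma gens_bij [simp]:
  "bij (s_perm :: 'k omega \<Rightarrow> _)" "bij (j_perm :: 'k omega \<Rightarrow> _)" "bij (t_perm :: 'k omega \<Rightarrow> _)"
  "bij (u_perm :: 'k omega \<Rightarrow> _)" "bij (v_perm \<zeta>)" "bij (r_perm \<zeta>)"
  using gens_square o_bij by (blast, blast, blast, blast, blast, metis o_assoc o_bij)

lemma gens_inv:
  "inv\<^bsub>BijGroup UNIV\<^esub> s_perm = (s_perm :: 'k omega \<Rightarrow> _)" "inv\<^bsub>BijGroup UNIV\<^esub> j_perm = (j_perm :: 'k omega \<Rightarrow> _)"
  "inv\<^bsub>BijGroup UNIV\<^esub> t_perm = (t_perm :: 'k omega \<Rightarrow> _)" "inv\<^bsub>BijGroup UNIV\<^esub> u_perm = (u_perm :: 'k omega \<Rightarrow> _)"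
  "inv\<^bsub>BijGroup UNIV\<^esub> (v_perm \<zeta>) = v_perm \<zeta>"
  "inv\<^bsub>BijGroup UNIV\<^esub> (r_perm \<zeta>) = r_perm \<zeta> \<circ> r_perm \<zeta>"
  using gens_square by (simp_all add: inv_BijGroup_UNIV o_assoc)

text \<open>The bracketing, and \<open>r \<circ> r\<close> for the inverse of \<open>r\<close>,
  match what unfolding \<open>M23_relations_in\<close> in the permutation group produces.\<close>

lemma relation_perms:
  fixes s j t r u v :: "'k omega \<Rightarrow> 'k omega"
  assumes "s = s_perm" "j = j_perm" "t = t_perm" "r = r_perm \<zeta>" "u = u_perm" "v = v_perm \<zeta>"
  shows "j \<circ> r \<circ> (j \<circ> r) = id" "t \<circ> r \<circ> (t \<circ> r) = id" "s \<circ> r \<circ> (s \<circ> r) \<circ> (s \<circ> r) = id"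
    "j \<circ> s \<circ> (j \<circ> s) \<circ> (j \<circ> s) = id" "t \<circ> j \<circ> (t \<circ> j) \<circ> (t \<circ> j) = id"
    "t \<circ> s \<circ> t \<circ> j \<circ> s \<circ> (t \<circ> s \<circ> t \<circ> j \<circ> s) \<circ> (t \<circ> s \<circ> t \<circ> j \<circ> s) = id"
    "t \<circ> s \<circ> t \<circ> (j \<circ> r) \<circ> (t \<circ> s \<circ> t) =
      r \<circ> s \<circ> (r \<circ> r) \<circ> j \<circ> r \<circ> (t \<circ> s \<circ> t) \<circ> (r \<circ> s \<circ> (r \<circ> r) \<circ> j \<circ> (r \<circ> r) \<circ> s \<circ> (r \<circ> r))"
    "u \<circ> s \<circ> (u \<circ> s) = id" "u \<circ> j \<circ> (u \<circ> j) \<circ> (u \<circ> j) = id" "u \<circ> r \<circ> u = j \<circ> r \<circ> j"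
    "u \<circ> t \<circ> s \<circ> (t \<circ> u) = s \<circ> (t \<circ> s \<circ> t)"
    "u \<circ> (t \<circ> j) \<circ> s \<circ> (j \<circ> t \<circ> u) = t \<circ> j \<circ> s \<circ> (j \<circ> t) \<circ> (t \<circ> (j \<circ> t) \<circ> s \<circ> (t \<circ> j \<circ> t))"
    "v \<circ> s \<circ> (v \<circ> s) = id" "v \<circ> u \<circ> (v \<circ> u) \<circ> (v \<circ> u) = id" "v \<circ> j \<circ> (v \<circ> j) = id"
    "v \<circ> r \<circ> (v \<circ> r) = id"
    "v \<circ> t \<circ> s \<circ> (t \<circ> v) = r \<circ> r \<circ> t \<circ> s \<circ> (t \<circ> r)"
    "v \<circ> (t \<circ> j) \<circ> s \<circ> (j \<circ> t \<circ> v) = r \<circ> r \<circ> (t \<circ> j) \<circ> s \<circ> (j \<circ> t \<circ> r)"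
  unfolding assms by (rule perm_eqI; simp add: perm_simps)+

lemma M23_relations_perms:
  assumes "(f, g) \<in> M23_relations_in (BijGroup UNIV) s_perm j_perm t_perm (r_perm \<zeta>) u_perm (v_perm \<zeta>)"
  shows "f = g"
proof -
  interpret B: group "BijGroup (UNIV :: 'k omega set)" by (rule group_BijGroup)
  note rels = relation_perms[OF refl refl refl refl refl refl] gens_square
  have inv_mult: "inv\<^bsub>BijGroup UNIV\<^esub> (f \<circ> g) = inv\<^bsub>BijGroup UNIV\<^esub> g \<otimes>\<^bsub>BijGroup UNIV\<^esub> inv\<^bsub>BijGroup UNIV\<^esub> f"
    if "bij f" "bij g" for f g :: "'k omega \<Rightarrow> 'k omega"
    using that B.inv_mult_group[of f g] by (simp add: carrier_BijGroup_UNIV mult_BijGroup_UNIV)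
  show ?thesis
    using assms unfolding M23_relations_in_def conj_by_def
    by (simp only: mult_BijGroup_UNIV pow_BijGroup_UNIV one_BijGroup_UNIV gens_bij bij_comp gens_inv
        inv_mult insert_iff empty_iff prod.inject)
      (elim disjE conjE FalseE; simp only: rels)
qed

end

section \<open>The action on the points\<close>

locale M23_action = M23_group \<zeta> G s j t r u v
  for \<zeta> :: "'k::field" and G :: "('a, 'b) monoid_scheme" (structure) and s j t r u v +
  fixes \<phi> :: "'a \<Rightarrow> 'k omega \<Rightarrow> 'k omega"
  assumes hom: "\<phi> \<in> hom G (BijGroup UNIV)"
    and \<phi>_gens: "\<phi> s = s_perm" "\<phi> j = j_perm" "\<phi> t = t_perm" "\<phi> r = r_perm \<zeta>" "\<phi> u = u_perm"
      "\<phi> v = v_perm \<zeta>"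
begin

lemma \<phi>_bij: "x \<in> carrier G \<Longrightarrow> bij (\<phi> x)"
  using hom_in_carrier[OF hom] by (simp add: carrier_BijGroup_UNIV)

lemma \<phi>_mult: "x \<in> carrier G \<Longrightarrow> y \<in> carrier G \<Longrightarrow> \<phi> (x \<otimes> y) = \<phi> x \<circ> \<phi> y"
  by (simp add: hom_mult[OF hom] mult_BijGroup_UNIV \<phi>_bij)

lemma \<phi>_one: "\<phi> \<one> = id"
  using hom_one[OF hom is_group group_BijGroup] by (simp add: one_BijGroup_UNIV)

lemma \<phi>_inv: "x \<in> carrier G \<Longrightarrow> \<phi> x \<circ> \<phi> (inv x) = id" "x \<in> carrier G \<Longrightarrow> \<phi> (inv x) \<circ> \<phi> x = id"
  by (simp_all add: \<phi>_one flip: \<phi>_mult)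

section \<open>Stabilizers of point sets and the kernel\<close>

definition stabilizer where "stabilizer D = {g \<in> carrier G. \<phi> g ` D = D}"

lemma stabilizer_subgroup: "subgroup (stabilizer D) G"
proof (rule subgroupI)
  show "stabilizer D \<noteq> {}" by (auto simp: stabilizer_def \<phi>_one intro!: exI[of _ \<one>])
  fix g assume g: "g \<in> stabilizer D"
  then have gD: "g \<in> carrier G" "\<phi> g ` D = D" by (simp_all add: stabilizer_def)
  have "\<phi> (inv g) ` (\<phi> g ` D) = D" unfolding image_comp by (simp add: gD \<phi>_inv)
  then show "inv g \<in> stabilizer D" using gD by (simp add: stabilizer_def)
  fix h assume "h \<in> stabilizer D"
  then have "(\<phi> g \<circ> \<phi> h) ` D = D" unfolding image_comp[symmetric] by (simp add: gD stabilizer_def)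
  with gD \<open>h \<in> stabilizer D\<close> show "g \<otimes> h \<in> stabilizer D" by (simp add: stabilizer_def \<phi>_mult)
qed (auto simp: stabilizer_def)

text \<open>If \<open>g = a x b\<close> acted trivially, write \<open>d\<close> as the image under
  \<open>b\<close> of some \<open>e\<close> in \<open>D\<close>. Then \<open>a\<close> maps the
  point \<open>\<phi> x d\<close> to \<open>e\<close>; as \<open>a\<close> preserves
  \<open>D\<close>, that point would lie in \<open>D\<close>.\<close>

lemma kernel_descent:
  assumes "S \<subseteq> stabilizer D" "x \<in> carrier G" "d \<in> D" "\<phi> x d \<notin> D"
    and "g \<in> double_coset_union G S x" "\<phi> g = id"
  shows "g \<in> S"
  using assms(5)
proof (cases rule: double_coset_unionE)
  case (2 a b)
  then have ab: "a \<in> carrier G" "\<phi> a ` D = D" "b \<in> carrier G" "\<phi> b ` D = D"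
    using assms(1) by (auto simp: stabilizer_def)
  then obtain e where e: "e \<in> D" "d = \<phi> b e" using assms(3) by blast
  have "\<phi> a (\<phi> x d) = \<phi> g e"
    using ab assms(2) by (simp add: 2 e \<phi>_mult)
  then have "\<phi> a (\<phi> x d) \<in> \<phi> a ` D" using e ab assms(6) by simp
  then have "\<phi> x d \<in> D"
    using \<phi>_bij[OF ab(1)] by (metis bij_is_inj inj_image_mem_iff)
  with assms(4) show ?thesis by simp
qed

lemma \<phi>_k: "\<phi> k = j_perm \<circ> (t_perm \<circ> j_perm)"
  by (simp add: k_def \<phi>_mult \<phi>_gens)

lemma \<phi>_x23_one: "\<phi> (x23 1) = t_perm \<circ> (j_perm \<circ> (s_perm \<circ> (j_perm \<circ> t_perm)))"
  by (simp add: x23_def x12_one \<phi>_mult \<phi>_gens)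

lemma psl_part_subset:
  assumes M: "subgroup M G" and mem: "s \<in> M" "j \<in> M" "t \<in> M" "r \<in> M"
  shows "psl_part \<subseteq> M"
proof -
  have "x23 1 \<in> M" "k \<in> M"
    unfolding x23_def k_def x12_one by (intro subgroup.m_closed[OF M] mem)+
  then have "point_stab \<subseteq> M"
    using mem unfolding point_stab_def
    by (intro double_coset_union_subset borel_subset M)
  with mem show ?thesis
    unfolding psl_part_def by (intro double_coset_union_subset M)
qed

lemma psl_part_new: "psl_part \<subseteq> stabilizer {New_u}" "psl_part \<subseteq> stabilizer {New_v}"
  by (rule psl_part_subset[OF stabilizer_subgroup]; simp add: stabilizer_def \<phi>_gens gens_new)+

lemma m22_part_new: "m22_part \<subseteq> stabilizer {New_v}"
  unfolding m22_part_def
  by (rule double_coset_union_subset[OF stabilizer_subgroup psl_part_new(2)])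
    (simp add: stabilizer_def \<phi>_gens)

lemma point_stab_point: "point_stab \<subseteq> stabilizer {Pt (pt 1 0 0)}"
  unfolding point_stab_def
  by (intro double_coset_union_subset[OF stabilizer_subgroup] borel_subset[OF stabilizer_subgroup])
    (simp_all add: stabilizer_def \<phi>_gens \<phi>_k \<phi>_x23_one perm_simps)

definition line where
  "line = {Pt (pt 1 0 0), Pt (pt 1 1 0), Pt (pt 1 \<zeta> 0), Pt (pt 1 \<omega> 0), Pt (pt 0 1 0)}"

lemma borel_line: "borel \<subseteq> stabilizer line"
  by (rule borel_subset[OF stabilizer_subgroup])
    (auto simp: stabilizer_def line_def \<phi>_gens \<phi>_x23_one perm_simps)

section \<open>Root elements acting as transvections\<close>

lemma \<phi>_r':
  assumes "\<not> (x = 0 \<and> y = 0 \<and> z = 0)"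
  shows "\<phi> r' (Pt (pt x y z)) = Pt (pt (\<omega> * x) y (\<zeta> * z))"
proof -
  have "\<phi> r' = r_perm \<zeta> \<circ> r_perm \<zeta>" using \<phi>_mult[of r r] by (simp add: \<phi>_gens)
  then show ?thesis using assms by (simp add: gens_pt field_table field_table_left)
qed

lemma \<phi>_x12:
  assumes "\<not> (x = 0 \<and> y = 0 \<and> z = 0)"
  shows "\<phi> (x12 a) (Pt (pt x y z)) = Pt (pt (x + a * y) y z)"
proof -
  \<comment> \<open>Splitting according to a nonzero coordinate discharges the side conditions for
    the intermediate points.\<close>
  have xyz: "x \<noteq> 0 \<or> y \<noteq> 0 \<or> z \<noteq> 0" using assms by blast
  have one: "\<phi> (x12 1) (Pt (pt x y z)) = Pt (pt (x + y) y z)"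
    using assms by (simp add: x12_one \<phi>_gens gens_pt)
  have "\<phi> (x12 \<zeta>) (Pt (pt x y z)) = Pt (pt (x + \<zeta> * y) y z)"
    using xyz unfolding x12_zeta
    by (elim disjE; simp add: \<phi>_mult \<phi>_gens \<phi>_r' gens_pt field_table field_table_left
        distrib_left cong: conj_cong)
  moreover have "\<phi> (x12 (\<zeta> + 1)) (Pt (pt x y z)) = Pt (pt (x + (\<zeta> + 1) * y) y z)"
    using xyz unfolding x12_zeta
    by (elim disjE; simp add: \<phi>_mult \<phi>_gens \<phi>_r' gens_pt field_table field_table_left
        distrib_left cong: conj_cong flip: \<omega>_def)
  ultimately show ?thesis using one field_cases[of a] by (auto simp: \<phi>_one)
qed

lemma \<phi>_roots:
  assumes "\<not> (x = 0 \<and> y = 0 \<and> z = 0)"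
  shows "\<phi> (x21 a) (Pt (pt x y z)) = Pt (pt x (y + a * x) z)"
    "\<phi> (x32 a) (Pt (pt x y z)) = Pt (pt x y (z + a * y))"
    "\<phi> (x31 a) (Pt (pt x y z)) = Pt (pt x y (z + a * x))"
    "\<phi> (x23 a) (Pt (pt x y z)) = Pt (pt x (y + a * z) z)"
    "\<phi> (x13 a) (Pt (pt x y z)) = Pt (pt (x + a * z) y z)"
proof -
  \<comment> \<open>The letters of each root word act successively on permuted and sheared vectors;
    \<open>perms\<close> and \<open>shears\<close> state that none of these vanishes.\<close>
  have perms: "\<not> (y = 0 \<and> x = 0 \<and> z = 0)" "\<not> (z = 0 \<and> y = 0 \<and> x = 0)"
    "\<not> (y = 0 \<and> z = 0 \<and> x = 0)" "\<not> (z = 0 \<and> x = 0 \<and> y = 0)" "\<not> (x = 0 \<and> z = 0 \<and> y = 0)"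
    using assms by auto
  have shears: "\<not> (y + a * x = 0 \<and> x = 0 \<and> z = 0)"
    "\<not> (z + a * y = 0 \<and> y = 0 \<and> x = 0)"
    "\<not> (z + a * x = 0 \<and> x = 0 \<and> y = 0)" "\<not> (y = 0 \<and> x = 0 \<and> z + a * x = 0)"
    "\<not> (y + a * z = 0 \<and> z = 0 \<and> x = 0)" "\<not> (z = 0 \<and> y + a * z = 0 \<and> x = 0)"
    "\<not> (x + a * z = 0 \<and> z = 0 \<and> y = 0)" "\<not> (z = 0 \<and> x + a * z = 0 \<and> y = 0)"
    "\<not> (y = 0 \<and> x + a * z = 0 \<and> z = 0)"
    using assms by auto
  show "\<phi> (x21 a) (Pt (pt x y z)) = Pt (pt x (y + a * x) z)"
    "\<phi> (x32 a) (Pt (pt x y z)) = Pt (pt x y (z + a * y))"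
    "\<phi> (x31 a) (Pt (pt x y z)) = Pt (pt x y (z + a * x))"
    "\<phi> (x23 a) (Pt (pt x y z)) = Pt (pt x (y + a * z) z)"
    "\<phi> (x13 a) (Pt (pt x y z)) = Pt (pt (x + a * z) y z)"
    by (simp_all only: root_defs \<phi>_mult \<phi>_gens o_apply m_closed gens_closed x12_closed
        gens_pt \<phi>_x12 assms perms shears simp_thms)
qed

text \<open>The image of \<open>[0,0,1]\<close> reveals \<open>c\<close> and then \<open>b\<close>,
  the image of \<open>[0,1,0]\<close> reveals \<open>a\<close>, and \<open>[1,1,0]\<close> separates
  the three torus elements.\<close>

lemma borel_faithful:
  assumes "g \<in> borel" "\<phi> g = id"
  shows "g = \<one>"
proof -
  from assms(1) obtain a b c h where g: "g = x12 a \<otimes> x13 b \<otimes> x23 c \<otimes> h" and h: "h \<in> torus"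
    by (rule borelE)
  have h_fix: "\<phi> h (Pt (pt 0 0 1)) = Pt (pt 0 0 1)" "\<phi> h (Pt (pt 0 1 0)) = Pt (pt 0 1 0)"
    using h pt_scale[of \<zeta> 0 0 1] pt_scale[of \<omega> 0 0 1]
    by (auto simp: field_table torus_def \<phi>_one \<phi>_gens gens_pt \<phi>_r')
  have act: "\<phi> g p = \<phi> (x12 a) (\<phi> (x13 b) (\<phi> (x23 c) (\<phi> h p)))" for p
    using h by (simp add: g \<phi>_mult)
  have "\<phi> g (Pt (pt 0 0 1)) = Pt (pt (b + a * c) c 1)"
    unfolding act by (simp add: h_fix \<phi>_roots \<phi>_x12)
  then have "c = 0" "b = 0" using assms(2) by (auto simp: pt_eq_iff)
  have "\<phi> g (Pt (pt 0 1 0)) = Pt (pt a 1 0)"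
    unfolding act by (simp add: h_fix \<phi>_roots \<phi>_x12)
  then have "a = 0" using assms(2) by (auto simp: pt_eq_iff)
  have gh: "g = h" using h by (simp add: g \<open>a = 0\<close> \<open>b = 0\<close> \<open>c = 0\<close>)
  have "\<phi> h (Pt (pt 1 1 0)) = Pt (pt 1 1 0)" using assms(2) gh by simp
  then show ?thesis
    using h by (auto simp: gh torus_def \<phi>_gens \<phi>_r' gens_pt pt_eq_iff field_table)
qed

text \<open>Descends the chain with the test points \<open>New_v\<close>, \<open>New_u\<close>,
  \<open>[1,0,0]\<close> and \<open>[0,1,0]\<close>, moved out of the stabilized sets by
  \<open>v\<close>, \<open>u\<close>, \<open>j\<close> and \<open>k\<close>.\<close>

lemma faithful:
  assumes "g \<in> carrier G" "\<phi> g = id"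
  shows "g = \<one>"
proof -
  have "g \<in> m22_part"
    by (rule kernel_descent[OF m22_part_new, of v New_v])
      (use assms in \<open>simp_all add: \<phi>_gens flip: carrier_eq\<close>)
  then have "g \<in> psl_part"
    unfolding m22_part_def
    by (intro kernel_descent[OF psl_part_new(1), of u New_u]) (use assms in \<open>simp_all add: \<phi>_gens\<close>)
  then have "g \<in> point_stab"
    unfolding psl_part_def
    by (intro kernel_descent[OF point_stab_point, of j "Pt (pt 1 0 0)"])
      (use assms in \<open>simp_all add: \<phi>_gens perm_simps\<close>)
  then have "g \<in> borel"
    unfolding point_stab_def
    by (intro kernel_descent[OF borel_line, of k "Pt (pt 0 1 0)"])
      (use assms in \<open>simp_all add: \<phi>_k line_def perm_simps pt_eq_iff\<close>)
  then show ?thesis using assms(2) by (rule borel_faithful)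
qed

section \<open>Gaussian elimination inside the image\<close>

definition linear_part where "linear_part = {g \<in> carrier G. \<phi> g \<in> PSL3_perms}"

lemma linear_part_mult: "x \<in> linear_part \<Longrightarrow> y \<in> linear_part \<Longrightarrow> x \<otimes> y \<in> linear_part"
  by (simp add: linear_part_def \<phi>_mult PSL3_perms_comp)

lemma linear_part_gens:
  "s \<in> linear_part" "j \<in> linear_part" "t \<in> linear_part" "r \<in> linear_part"
  using linear_perms_PSL3[OF zeta_nonzero] by (simp_all add: linear_part_def \<phi>_gens minus_self)

lemma linear_part_roots:
  "x12 a \<in> linear_part" "x21 a \<in> linear_part" "x13 a \<in> linear_part" "x31 a \<in> linear_part"
  "x23 a \<in> linear_part" "x32 a \<in> linear_part" "k \<in> linear_part" "r' \<in> linear_part"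
proof -
  note [simp] = linear_part_mult linear_part_gens
  \<comment> \<open>Closure under products suffices: 1 and \<open>r'\<close> are the squares of
    \<open>s\<close> and \<open>r\<close>.\<close>
  have "s \<otimes> s \<in> linear_part" "r \<otimes> r \<in> linear_part"
    by (simp_all only: linear_part_mult linear_part_gens)
  then have [simp]: "\<one> \<in> linear_part" "r' \<in> linear_part" by simp_all
  show [simp]: "x12 a \<in> linear_part" by (simp add: x12_def)
  show "x21 a \<in> linear_part" "x13 a \<in> linear_part" "x31 a \<in> linear_part"
    "x23 a \<in> linear_part" "x32 a \<in> linear_part" "k \<in> linear_part" "r' \<in> linear_part"
    by (simp_all add: root_defs k_def)
qed

lemma image_cancel:
  assumes "g \<in> carrier G" "\<phi> g \<circ> f \<in> \<phi> ` carrier G"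
  shows "f \<in> \<phi> ` carrier G"
proof -
  from assms(2) obtain h where h: "h \<in> carrier G" "\<phi> g \<circ> f = \<phi> h" by blast
  have "f = \<phi> (inv g) \<circ> \<phi> g \<circ> f" using assms(1) by (simp add: \<phi>_inv)
  also have "\<dots> = \<phi> (inv g \<otimes> h)" using assms(1) h by (simp add: \<phi>_mult o_assoc[symmetric])
  finally show ?thesis using assms(1) h(1) by blast
qed

text \<open>One elimination step. Multiplying by an element of \<open>linear_part\<close> keeps the
  permutation in \<open>PSL3_perms\<close>, so the next step can again extract a matrix of
  determinant 1.\<close>

lemma linear_cancel:
  assumes "g \<in> linear_part" "f \<in> PSL3_perms"
    "\<phi> g \<circ> f \<in> PSL3_perms \<Longrightarrow> \<phi> g \<circ> f \<in> \<phi> ` carrier G"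
  shows "f \<in> \<phi> ` carrier G"
  using assms PSL3_perms_comp[of "\<phi> g" f] image_cancel[of g f] by (auto simp: linear_part_def)

lemma mat_perm_pt:
  fixes A :: "'k ^ 3 ^ 3"
  assumes "det A = 1" "\<not> (x = 0 \<and> y = 0 \<and> z = 0)"
  shows "mat_perm A (Pt (pt x y z)) = Pt (pt (A $ 1 $ 1 * x + A $ 1 $ 2 * y + A $ 1 $ 3 * z)
     (A $ 2 $ 1 * x + A $ 2 $ 2 * y + A $ 2 $ 3 * z)
     (A $ 3 $ 1 * x + A $ 3 $ 2 * y + A $ 3 $ 3 * z))"
  using assms by (simp add: mat_act_pt)

lemma det_column:
  fixes A :: "'k ^ 3 ^ 3"
  assumes "det A = 1"
  shows "\<not> (A $ 1 $ i = 0 \<and> A $ 2 $ i = 0 \<and> A $ 3 $ i = 0)"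
  using assms exhaust_3[of i] by (auto simp: det_3)

lemma mat_perm_fix:
  fixes A :: "'k ^ 3 ^ 3"
  assumes "det A = 1"
  shows "mat_perm A (Pt (pt 1 0 0)) = Pt (pt 1 0 0) \<Longrightarrow> A $ 2 $ 1 = 0 \<and> A $ 3 $ 1 = 0"
    "mat_perm A (Pt (pt 0 1 0)) = Pt (pt 0 1 0) \<Longrightarrow> A $ 1 $ 2 = 0 \<and> A $ 3 $ 2 = 0"
    "mat_perm A (Pt (pt 0 0 1)) = Pt (pt 0 0 1) \<Longrightarrow> A $ 1 $ 3 = 0 \<and> A $ 2 $ 3 = 0"
  using pt_eq_iff[OF det_column[OF assms, of 1], of 1 0 0] pt_eq_iff[OF det_column[OF assms, of 2], of 0 1 0]
    pt_eq_iff[OF det_column[OF assms, of 3], of 0 0 1]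
  by (simp_all add: mat_perm_pt[OF assms] del: mat_perm.simps) auto

text \<open>A matrix fixing the three coordinate points is diagonal. Scaled to middle entry 1, it
  becomes \<open>diag(d, 1, inverse d)\<close>, which acts as 1, \<open>r\<close> or
  \<open>r'\<close>.\<close>

lemma diagonal_in_image:
  assumes "f \<in> PSL3_perms" "f (Pt (pt 1 0 0)) = Pt (pt 1 0 0)" "f (Pt (pt 0 1 0)) = Pt (pt 0 1 0)"
    "f (Pt (pt 0 0 1)) = Pt (pt 0 0 1)"
  shows "f \<in> \<phi> ` carrier G"
proof -
  from assms(1) obtain A :: "'k ^ 3 ^ 3" where f: "f = mat_perm A" and det: "det A = 1"
    by (auto simp: PSL3_perms_def)
  have off: "A $ 2 $ 1 = 0" "A $ 3 $ 1 = 0" "A $ 1 $ 2 = 0" "A $ 3 $ 2 = 0" "A $ 1 $ 3 = 0" "A $ 2 $ 3 = 0"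
    using mat_perm_fix[OF det] assms(2-4) unfolding f by blast+
  define a b c where "a = A $ 1 $ 1" and "b = A $ 2 $ 2" and "c = A $ 3 $ 3"
  have abc: "a * b * c = 1" using det off by (simp add: det_3 a_def b_def c_def)
  then have nz: "a \<noteq> 0" "b \<noteq> 0" "c \<noteq> 0" by auto
  have [simp]: "inverse b * (b * w) = w" for w using nz by (simp flip: mult.assoc)
  have act: "f (Pt (pt x y z)) = Pt (pt (inverse b * a * x) y (inverse b * c * z))"
    if "\<not> (x = 0 \<and> y = 0 \<and> z = 0)" for x y z
    using pt_scale[of "inverse b" "a * x" "b * y" "c * z"] nz that
    by (simp add: f mat_perm_pt[OF det that] off mult.assoc del: mat_perm.simps flip: a_def b_def c_def)
  define d where "d = inverse b * a"
  have "inverse b * c * d = inverse (b * b * b) * (a * b * c)"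
    using nz by (simp add: d_def field_simps)
  \<comment> \<open>Nonzero elements have cube 1, so the scaled matrix still has determinant 1; this
    forces its last entry to be \<open>inverse d\<close>.\<close>
  also have "b * b * b = 1"
    using nz field_cases[of b] by (auto simp: gf4_simps)
  finally have "inverse b * c * d = 1" using abc by simp
  then have cd: "inverse b * c = inverse d" by (metis inverse_unique mult.commute)
  have "d \<noteq> 0" using nz by (simp add: d_def)
  then have d: "d = 1 \<or> d = \<zeta> \<or> d = \<zeta> + 1" using field_cases[of d] by simp
  then obtain h where h: "h \<in> torus" and
    h_act: "\<And>x y z. \<not> (x = 0 \<and> y = 0 \<and> z = 0) \<Longrightarrow> \<phi> h (Pt (pt x y z)) = Pt (pt (d * x) y (inverse d * z))"
  proof (elim disjE)
    assume d: "d = 1" show thesis by (rule that[of \<one>]) (simp_all add: torus_def \<phi>_one d)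
  next
    assume d: "d = \<zeta>" show thesis
      by (rule that[of r]) (simp_all add: torus_def \<phi>_gens gens_pt d inverse_zeta \<omega>_def)
  next
    assume d: "d = \<zeta> + 1" show thesis
      by (rule that[of r']) (simp_all add: torus_def \<phi>_r' d inverse_zeta \<omega>_def)
  qed
  have new: "\<phi> h New_u = New_u" "\<phi> h New_v = New_v"
    using h psl_part_new point_stab_psl_part[OF borel_point_stab[OF torus_borel[OF h]]]
    by (auto simp: stabilizer_def)
  have "f = \<phi> h"
  proof
    fix x show "f x = \<phi> h x"
    proof (cases x)
      case (Pt p)
      then show ?thesis by (cases p rule: pt_cases) (simp add: act h_act cd flip: d_def)
    qed (simp_all add: f new)
  qed
  then show ?thesis using h by simp
qed

text \<open>Clears the third column. In characteristic two, adding the entries \<open>x\<close> and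
  \<open>y\<close> once more cancels them.\<close>

lemma PSL3_fix_two:
  assumes "f \<in> PSL3_perms" "f (Pt (pt 1 0 0)) = Pt (pt 1 0 0)" "f (Pt (pt 0 1 0)) = Pt (pt 0 1 0)"
  shows "f \<in> \<phi> ` carrier G"
proof -
  from assms(1) obtain A :: "'k ^ 3 ^ 3" where f: "f = mat_perm A" and det: "det A = 1"
    by (auto simp: PSL3_perms_def)
  have off: "A $ 2 $ 1 = 0" "A $ 3 $ 1 = 0" "A $ 1 $ 2 = 0" "A $ 3 $ 2 = 0"
    using mat_perm_fix[OF det] assms(2,3) unfolding f by blast+
  define c where "c = A $ 3 $ 3"
  have c: "c \<noteq> 0" using det off by (auto simp: det_3 c_def)
  define x y where "x = inverse c * A $ 1 $ 3" and "y = inverse c * A $ 2 $ 3"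
  have f3: "f (Pt (pt 0 0 1)) = Pt (pt x y 1)"
    using pt_scale[of "inverse c" "A $ 1 $ 3" "A $ 2 $ 3" c] c
    by (simp add: f mat_perm_pt[OF det] x_def y_def del: mat_perm.simps flip: c_def)
  show ?thesis
  proof (rule linear_cancel[of "x13 x \<otimes> x23 y", OF _ assms(1)])
    show "x13 x \<otimes> x23 y \<in> linear_part" by (intro linear_part_mult linear_part_roots)
    show "\<phi> (x13 x \<otimes> x23 y) \<circ> f \<in> \<phi> ` carrier G" if "\<phi> (x13 x \<otimes> x23 y) \<circ> f \<in> PSL3_perms"
      using that by (rule diagonal_in_image) (simp_all add: assms f3 \<phi>_mult \<phi>_roots add_self)
  qed
qed

text \<open>Clears the second column by \<open>x12\<close> and \<open>x32\<close>, which fix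
  \<open>[1,0,0]\<close>; if the pivot vanishes, \<open>k\<close> first exchanges the last two
  coordinates.\<close>

lemma PSL3_fix_one:
  assumes "f \<in> PSL3_perms" "f (Pt (pt 1 0 0)) = Pt (pt 1 0 0)"
  shows "f \<in> \<phi> ` carrier G"
proof -
  have one: "f \<in> \<phi> ` carrier G"
    if "f \<in> PSL3_perms" "f (Pt (pt 1 0 0)) = Pt (pt 1 0 0)" "f (Pt (pt 0 1 0)) = Pt (pt x y z)" "y \<noteq> 0"
    for f x y z
  proof (rule linear_cancel[of "x32 (inverse y * z) \<otimes> x12 (inverse y * x)", OF _ that(1)])
    have f2: "f (Pt (pt 0 1 0)) = Pt (pt (inverse y * x) 1 (inverse y * z))"
      using that(3,4) pt_scale[of "inverse y" x y z] by simp
    let ?g = "x32 (inverse y * z) \<otimes> x12 (inverse y * x)"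
    show "?g \<in> linear_part" by (intro linear_part_mult linear_part_roots)
    show "\<phi> ?g \<circ> f \<in> \<phi> ` carrier G" if "\<phi> ?g \<circ> f \<in> PSL3_perms"
      using that
      by (rule PSL3_fix_two) (simp_all add: \<open>f (Pt (pt 1 0 0)) = _\<close> f2 \<phi>_mult \<phi>_roots \<phi>_x12 add_self)
  qed
  from assms(1) obtain A :: "'k ^ 3 ^ 3" where f: "f = mat_perm A" and det: "det A = 1"
    by (auto simp: PSL3_perms_def)
  have off: "A $ 2 $ 1 = 0" "A $ 3 $ 1 = 0"
    using mat_perm_fix[OF det] assms(2) unfolding f by blast+
  have f2: "f (Pt (pt 0 1 0)) = Pt (pt (A $ 1 $ 2) (A $ 2 $ 2) (A $ 3 $ 2))"
    by (simp add: f mat_perm_pt[OF det] del: mat_perm.simps)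
  show ?thesis
  proof (cases "A $ 2 $ 2 = 0")
    case False
    then show ?thesis by (rule one[OF assms f2])
  next
    case True
    \<comment> \<open>The first column is a multiple of the first unit vector, so a second column
      vanishing in both lower entries would make the determinant zero.\<close>
    then have 3: "A $ 3 $ 2 \<noteq> 0" using det off by (auto simp: det_3)
    show ?thesis
    proof (rule linear_cancel[of k, OF linear_part_roots(7) assms(1)])
      assume "\<phi> k \<circ> f \<in> PSL3_perms"
      then show "\<phi> k \<circ> f \<in> \<phi> ` carrier G"
        by (rule one[OF _ _ _ 3, where x = "A $ 1 $ 2" and z = "A $ 2 $ 2"])
          (use 3 in \<open>simp_all add: assms f2 \<phi>_k gens_pt\<close>)
    qed
  qed
qed

text \<open>Clears the first column by \<open>x21\<close> and \<open>x31\<close>, after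
  \<open>j\<close> or \<open>t\<close> has brought a nonzero entry to the top if necessary.\<close>

lemma PSL3_in_image:
  assumes "f \<in> PSL3_perms"
  shows "f \<in> \<phi> ` carrier G"
proof -
  have one: "f \<in> \<phi> ` carrier G" if "f \<in> PSL3_perms" "f (Pt (pt 1 0 0)) = Pt (pt 1 a b)" for f a b
  proof (rule linear_cancel[of "x21 a \<otimes> x31 b", OF _ that(1)])
    show "x21 a \<otimes> x31 b \<in> linear_part" by (intro linear_part_mult linear_part_roots)
    show "\<phi> (x21 a \<otimes> x31 b) \<circ> f \<in> \<phi> ` carrier G" if "\<phi> (x21 a \<otimes> x31 b) \<circ> f \<in> PSL3_perms"
      using that by (rule PSL3_fix_one) (simp add: \<open>f _ = _\<close> \<phi>_mult \<phi>_roots add_self)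
  qed
  from assms obtain p where p: "f (Pt (pt 1 0 0)) = Pt p" by (auto simp: PSL3_perms_def)
  then show ?thesis
  proof (cases "f (Pt (pt 1 0 0))" rule: omega_cases)
    case (3 a b)
    with assms show ?thesis by (rule one)
  next
    case (4 a)
    show ?thesis
      by (rule linear_cancel[of j, OF linear_part_gens(2) assms], erule one[of _ 0 a])
        (simp add: 4 \<phi>_gens gens_pt)
  next
    case 5
    show ?thesis
      by (rule linear_cancel[of t, OF linear_part_gens(3) assms], erule one[of _ 0 0])
        (simp add: 5 \<phi>_gens gens_pt)
  qed simp_all
qed

section \<open>The isomorphism\<close>

lemma image_eq: "\<phi> ` carrier G = generate (BijGroup UNIV) (PSL3_perms \<union> {u_perm, v_perm \<zeta>})"
proof
  interpret \<phi>: group_hom G "BijGroup (UNIV :: 'k omega set)" \<phi>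
    by (rule group_hom.intro) (simp_all add: group_BijGroup group_hom_axioms_def hom)
  have "\<phi> ` carrier G = generate (BijGroup UNIV) (\<phi> ` {s, j, t, r, u, v})"
    by (subst \<phi>.generate_img) (simp_all add: generated)
  also have "\<dots> \<subseteq> generate (BijGroup UNIV) (PSL3_perms \<union> {u_perm, v_perm \<zeta>})"
    using linear_perms_PSL3[OF zeta_nonzero]
    by (intro \<phi>.H.mono_generate) (auto simp: \<phi>_gens minus_self)
  finally show "\<phi> ` carrier G \<subseteq> generate (BijGroup UNIV) (PSL3_perms \<union> {u_perm, v_perm \<zeta>})" .
  have "subgroup (\<phi> ` carrier G) (BijGroup UNIV)"
    by (rule \<phi>.img_is_subgroup)
  moreover have "PSL3_perms \<union> {u_perm, v_perm \<zeta>} \<subseteq> \<phi> ` carrier G"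
    using PSL3_in_image imageI[of u "carrier G" \<phi>] imageI[of v "carrier G" \<phi>]
    by (auto simp: \<phi>_gens)
  ultimately show "generate (BijGroup UNIV) (PSL3_perms \<union> {u_perm, v_perm \<zeta>}) \<subseteq> \<phi> ` carrier G"
    by (intro \<phi>.H.generate_subgroup_incl)
qed

lemma \<phi>_iso: "\<phi> \<in> iso G (M23 \<zeta>)"
proof -
  have "inj_on \<phi> (carrier G)"
  proof (rule inj_onI)
    fix x y assume xy: "x \<in> carrier G" "y \<in> carrier G" "\<phi> x = \<phi> y"
    then have "\<phi> (x \<otimes> inv y) = id" by (simp add: \<phi>_mult \<phi>_inv)
    then have "x \<otimes> inv y = \<one>" using xy by (intro faithful) simp_all
    then show "x = y" using xy by (metis inv_equality inv_inv inv_closed)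
  qed
  moreover have "\<phi> \<in> hom G (M23 \<zeta>)"
    using hom image_eq by (auto simp: hom_def M23_def)
  ultimately show ?thesis
    by (simp add: iso_def bij_betw_def image_eq) (simp add: M23_def)
qed

end

theorem proposition7p6:
  fixes \<zeta> :: "'k::field"
  assumes "CARD('k) = 4" and "primitive_element \<zeta>"
  shows "\<exists>\<phi> \<in> iso (presented_group M23_relations) (M23 \<zeta>).
     \<phi> (presented_gen M23_relations sym_s) = s_perm \<and>
     \<phi> (presented_gen M23_relations sym_j) = j_perm \<and>
     \<phi> (presented_gen M23_relations sym_t) = t_perm \<and>
     \<phi> (presented_gen M23_relations sym_r) = r_perm \<zeta> \<and>
     \<phi> (presented_gen M23_relations sym_u) = u_perm \<and>
     \<phi> (presented_gen M23_relations sym_v) = v_perm \<zeta>"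
proof -
  interpret gf4 \<zeta> by unfold_locales (fact assms)+
  interpret B: group "BijGroup (UNIV :: 'k omega set)" by (rule group_BijGroup)
  let ?P = "presented_group M23_relations" and ?gen = "presented_gen M23_relations"
  define f where "f = case_M23_symbol s_perm j_perm t_perm (r_perm \<zeta>) u_perm (v_perm \<zeta>)"
  have "f a \<in> carrier (BijGroup UNIV)" for a
    by (cases a) (simp_all add: f_def carrier_BijGroup_UNIV)
  then obtain h where h: "h \<in> hom free_group (BijGroup UNIV)" "\<And>a. h (free_gen a) = f a"
    by (rule B.free_group_hom_exists[of f]) blast
  interpret h: group_hom free_group "BijGroup (UNIV :: 'k omega set)" h
    by (rule group_hom.intro) (simp_all add: group_BijGroup group_free_group group_hom_axioms_def h)
  have "h x = h y" if "(x, y) \<in> M23_relations" for x y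
  proof (rule M23_relations_perms)
    \<comment> \<open>Relations are mapped as pairs, so that their image under \<open>h\<close> is
      the same list of relations for the permutations.\<close>
    have "(h x, h y) \<in> map_prod h h ` M23_relations" using that by force
    also have "map_prod h h ` M23_relations =
        M23_relations_in (BijGroup UNIV) s_perm j_perm t_perm (r_perm \<zeta>) u_perm (v_perm \<zeta>)"
      unfolding M23_relations_def by (subst h.M23_relations_in_image[symmetric]) (simp_all add: h f_def)
    finally show "(h x, h y) \<in> \<dots>" .
  qed
  then obtain \<phi> where \<phi>: "\<phi> \<in> hom ?P (BijGroup UNIV)" "\<And>a. \<phi> (?gen a) = f a"
    using B.presented_group_hom_exists[OF h(1), of M23_relations] unfolding h(2) by metis
  interpret q: group_hom free_group ?P "presented_class M23_relations"
    by (rule presented_class_hom)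
  have "M23_action \<zeta> ?P (?gen sym_s) (?gen sym_j) (?gen sym_t) (?gen sym_r) (?gen sym_u) (?gen sym_v) \<phi>"
  proof (unfold_locales)
    have "?gen a \<in> ?gen ` {sym_s, sym_j, sym_t, sym_r, sym_u, sym_v}" for a
      by (cases a) simp_all
    then have "range ?gen = ?gen ` {sym_s, sym_j, sym_t, sym_r, sym_u, sym_v}" by blast
    then show "generate ?P {?gen sym_s, ?gen sym_j, ?gen sym_t, ?gen sym_r, ?gen sym_u, ?gen sym_v} =
        carrier ?P"
      using presented_group_generate[of M23_relations] by simp
    \<comment> \<open>The same transport along the quotient map: the relations in \<open>?P\<close>
      are images of those in the free group, whose two sides have equal classes.\<close>
    have image: "M23_relations_in ?P (?gen sym_s) (?gen sym_j) (?gen sym_t) (?gen sym_r) (?gen sym_u)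
        (?gen sym_v) = map_prod (presented_class M23_relations) (presented_class M23_relations) ` M23_relations"
      using q.M23_relations_in_image[of "free_gen sym_s" "free_gen sym_j" "free_gen sym_t"
          "free_gen sym_r" "free_gen sym_u" "free_gen sym_v"]
      by (simp add: presented_class_gen flip: M23_relations_def)
    fix x y
    assume "(x, y) \<in> M23_relations_in ?P (?gen sym_s) (?gen sym_j) (?gen sym_t) (?gen sym_r) (?gen sym_u)
        (?gen sym_v)"
    then show "x = y" unfolding image by (auto dest: presented_group_relation)
  qed (simp_all add: presented_gen_closed \<phi> f_def)
  then have "\<phi> \<in> iso ?P (M23 \<zeta>)" by (rule M23_action.\<phi>_iso)
  then show ?thesis by (intro bexI[of _ \<phi>]) (simp_all add: \<phi> f_def)
qed

end
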